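(* Let $(\mathcal{X},T)$ be a dynamical system with the marker property. Assume that $\overline{\mathrm{mdim}}_{M}(\mathcal{X},T,d)<\infty$ for all $d\in\mathcal{D}(\mathcal{X})$. Let $\mathcal{F}=\{\varphi_n\}_{n=1}^{\infty}$ be a sub-additive potential on $\mathcal{X}$ with bounded distortion, and suppose there exists $K>0$ such that $|\varphi_{n+1}(x)-\varphi_n(x)|\le K$ for all $x\in\mathcal{X}$ and $n\in\mathbb{N}$. Then $$\mathrm{mdim}(\mathcal{X},T,\mathcal{F})=\min_{d\in\mathcal{D}(\mathcal{X})}\ \sup_{\mu\in\mathcal{M}(\mathcal{X},T)}\left(\overline{\mathrm{rdim}}(\mathcal{X},T,d,\mu)+\mathcal{F}_*(\mu)\right)=\min_{d\in\mathcal{D}(\mathcal{X})}\ \sup_{\mu\in\mathcal{M}(\mathcal{X},T)}\left(\underline{\mathrm{rdim}}(\mathcal{X},T,d,\mu)+\mathcal{F}_*(\mu)\right).$$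
   Context: A dynamical system $(\mathcal{X},T)$ is a compact metrizable space $\mathcal{X}$ with a homeomorphism $T:\mathcal{X}\to\mathcal{X}$. $\mathcal{D}(\mathcal{X})$ is the set of metrics on $\mathcal{X}$ compatible with the topology; $\mathcal{M}(\mathcal{X},T)$ is the set of $T$-invariant Borel probability measures. For a metric $d$ and $N\ge1$, $d_N(x,y)=\max_{0\le n<N}d(T^nx,T^ny)$. Marker property: for every $N>0$ there is an open $U\subset\mathcal{X}$ with $\mathcal{X}=\bigcup_{n\in\mathbb{Z}}T^{-n}U$ and $U\cap T^{-n}U=\emptyset$ for $1\le n\le N$. Sub-additive potential: a sequence $\mathcal{F}=\{\varphi_n\}_{n\ge1}$ of continuous functions $\varphi_n:\mathcal{X}\to\mathbb{R}$ with $\varphi_{n+m}(x)\le\varphi_n(x)+\varphi_m(T^nx)$ for all $x\in\mathcal{X}$, $m,n\in\mathbb{N}$. For $\mu\in\mathcal{M}(\mathcal{X},T)$, $\mathcal{F}_*(\mu)=\lim_{n\to\infty}\frac1n\int\varphi_n\,d\mu\in[-\infty,\infty)$ (exists by subadditivity). Bounded distortion: with $\mathrm{var}_\epsilon(\varphi,d)=\sup\{|\varphi(x)-\varphi(y)|: d(x,y)<\epsilon\}$, $\mathcal{F}$ has bounded distortion if $\lim_{\epsilon\to0}\limsup_{n\to\infty}\mathrm{var}_\epsilon(\varphi_n,d_n)/n=0$, where $d$ is a metric on $\mathcal{X}$. Mean dimension with potential: simplicial complexes are finite. For a simplicial complex $P$ and $a\in P$, $\dim_aP$ is the maximum of $\dim\Delta$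 over simplexes $\Delta\subset P$ containing $a$. A continuous map $f$ from a compact metric space $(\mathcal{X},d)$ to a topological space $\mathcal{Y}$ is an $\epsilon$-embedding if $\mathrm{diam}\,f^{-1}(y)<\epsilon$ for all $y\in\mathcal{Y}$. For continuous $\varphi:\mathcal{X}\to\mathbb{R}$, $$\mathrm{Widim}_\epsilon(\mathcal{X},d,\varphi)=\inf\Big\{\max_{x\in\mathcal{X}}(\dim_{f(x)}P+\varphi(x)) : P\text{ a simplicial complex},\ f:\mathcal{X}\to P\text{ an }\epsilon\text{-embedding}\Big\}.$$ Set $\mathrm{mdim}(\mathcal{X},T,\mathcal{F})=\lim_{\epsilon\to0}\left(\lim_{N\to\infty}\frac{\mathrm{Widim}_\epsilon(\mathcal{X},d_N,\varphi_N)}{N}\right)$; the value is independent of the choice of $d$. Upper metric mean dimension (without potential): let $\#(\mathcal{X},d,\epsilon)$ be the minimum cardinality of an open cover of $\mathcal{X}$ by sets of $d$-diameter $<\epsilon$. Then $\overline{\mathrm{mdim}}_M(\mathcal{X},T,d)=\limsup_{\epsilon\to0}\frac{1}{\log(1/\epsilon)}\lim_{N\to\infty}\frac{\log\#(\mathcal{X},d_N,\epsilon)}{N}$. Rate distortion dimension: for random variables $X,Y$ taking values in measurable spaces, the mutual information $I(X;Y)$ is the supremum of $I(f\circ X;g\circ Y)$ over measurable maps $f,g$ with finite range, where for finite-valued variables $I(X;Y)=H(X)+H(Y)-H(X,Y)$ ($H$ = Shannon entropy). For $\mu\in\mathcal{M}(\mathcal{X},T)$ and $\epsilon>0$, $R_\mu(\epsilon)=R(d,\mu,\epsilon)$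 is the infimum of $I(X;Y)/n$ over all $n\in\mathbb{N}$ and all random variables $X$ and $Y=(Y_0,\dots,Y_{n-1})$ on some probability space such that $X$ takes values in $\mathcal{X}$ with law $\mu$, each $Y_k$ takes values in $\mathcal{X}$, and $\mathbb{E}\left(\frac1n\sum_{k=0}^{n-1}d(T^kX,Y_k)\right)<\epsilon$. Then $\overline{\mathrm{rdim}}(\mathcal{X},T,d,\mu)=\limsup_{\epsilon\to0}R_\mu(\epsilon)/\log(1/\epsilon)$ and $\underline{\mathrm{rdim}}(\mathcal{X},T,d,\mu)=\liminf_{\epsilon\to0}R_\mu(\epsilon)/\log(1/\epsilon)$. *)

theory Defs
  imports "HOL-Probability.Probability"
begin

text \<open>
  Spaces are abstract topologies. Extended real values are used throughout, so that every supremum,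
  infimum, limsup and liminf is defined; \<open>lim\<close> and \<open>Lim\<close> are the library's limit
  operators. All logarithms are natural.
\<close>

section \<open>Dynamical systems\<close>

definition dynamical_system :: "'a topology \<Rightarrow> ('a \<Rightarrow> 'a) \<Rightarrow> bool" where
  "dynamical_system X T \<longleftrightarrow> compact_space X \<and> metrizable_space X \<and> homeomorphic_map X X T"

definition compatible_metrics :: "'a topology \<Rightarrow> ('a \<Rightarrow> 'a \<Rightarrow> real) set" where
  "compatible_metrics X =
     {d. Metric_space (topspace X) d \<and> Metric_space.mtopology (topspace X) d = X}"

definition borel_algebra :: "'a topology \<Rightarrow> 'a measure" where
  "borel_algebra X = sigma (topspace X) {U. openin X U}"

definition invariant_measures :: "'a topology \<Rightarrow> ('a \<Rightarrow> 'a) \<Rightarrow> 'a measure set" where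
  "invariant_measures X T =
     {\<mu>. prob_space \<mu> \<and> sets \<mu> = sets (borel_algebra X) \<and> distr \<mu> \<mu> T = \<mu>}"

definition int_iterate :: "'a topology \<Rightarrow> ('a \<Rightarrow> 'a) \<Rightarrow> int \<Rightarrow> 'a \<Rightarrow> 'a" where
  "int_iterate X T n =
     (if 0 \<le> n then T ^^ nat n else inv_into (topspace X) T ^^ nat (- n))"

text \<open>The set \<open>T\<^sup>-\<^sup>n U\<close>.\<close>

definition shift_preimage :: "'a topology \<Rightarrow> ('a \<Rightarrow> 'a) \<Rightarrow> int \<Rightarrow> 'a set \<Rightarrow> 'a set" where
  "shift_preimage X T n U = {x \<in> topspace X. int_iterate X T n x \<in> U}"

definition marker_property :: "'a topology \<Rightarrow> ('a \<Rightarrow> 'a) \<Rightarrow> bool" where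
  "marker_property X T \<longleftrightarrow>
     (\<forall>N::nat. 0 < N \<longrightarrow>
       (\<exists>U. openin X U \<and> topspace X = (\<Union>n::int. shift_preimage X T n U) \<and>
            (\<forall>n\<in>{1..N}. U \<inter> shift_preimage X T (int n) U = {})))"

text \<open>The Bowen metric \<open>d\<^sub>N\<close>, meaningful for \<open>N \<ge> 1\<close>.\<close>

definition dyn_metric ::
  "('a \<Rightarrow> 'a) \<Rightarrow> ('a \<Rightarrow> 'a \<Rightarrow> real) \<Rightarrow> nat \<Rightarrow> 'a \<Rightarrow> 'a \<Rightarrow> real" where
  "dyn_metric T d N x y = Max ((\<lambda>n. d ((T ^^ n) x) ((T ^^ n) y)) ` {..<N})"

definition diam :: "('a \<Rightarrow> 'a \<Rightarrow> real) \<Rightarrow> 'a set \<Rightarrow> ereal" where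
  "diam d S = (if S = {} then 0 else SUP (x, y)\<in>S \<times> S. ereal (d x y))"


section \<open>Potentials\<close>

text \<open>A potential is a family indexed by \<open>n \<ge> 1\<close>; the value at index \<open>0\<close> is irrelevant.\<close>

definition subadditive_potential ::
  "'a topology \<Rightarrow> ('a \<Rightarrow> 'a) \<Rightarrow> (nat \<Rightarrow> 'a \<Rightarrow> real) \<Rightarrow> bool" where
  "subadditive_potential X T \<phi> \<longleftrightarrow>
     (\<forall>n\<ge>1. continuous_map X euclideanreal (\<phi> n)) \<and>
     (\<forall>n\<ge>1. \<forall>m\<ge>1. \<forall>x\<in>topspace X. \<phi> (n + m) x \<le> \<phi> n x + \<phi> m ((T ^^ n) x))"

definition potential_average :: "(nat \<Rightarrow> 'a \<Rightarrow> real) \<Rightarrow> 'a measure \<Rightarrow> ereal" where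
  "potential_average \<phi> \<mu> = lim (\<lambda>n. ereal (1 / real n * (LINT x|\<mu>. \<phi> n x)))"

definition variation :: "'a topology \<Rightarrow> real \<Rightarrow> ('a \<Rightarrow> real) \<Rightarrow> ('a \<Rightarrow> 'a \<Rightarrow> real) \<Rightarrow> ereal" where
  "variation X \<epsilon> \<psi> d =
     (SUP (x, y)\<in>{(x, y). x \<in> topspace X \<and> y \<in> topspace X \<and> d x y < \<epsilon>}. ereal \<bar>\<psi> x - \<psi> y\<bar>)"

text \<open>
  By uniform continuity the condition does not depend on the compatible metric \<open>d\<close>, so it is
  required for some such metric only.
\<close>

definition bounded_distortion ::
  "'a topology \<Rightarrow> ('a \<Rightarrow> 'a) \<Rightarrow> (nat \<Rightarrow> 'a \<Rightarrow> real) \<Rightarrow> bool" where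
  "bounded_distortion X T \<phi> \<longleftrightarrow>
     (\<exists>d\<in>compatible_metrics X.
       ((\<lambda>\<epsilon>. limsup (\<lambda>n. variation X \<epsilon> (\<phi> n) (dyn_metric T d n) / ereal (real n)))
          \<longlongrightarrow> 0) (at_right 0))"


section \<open>Mean dimension with potential\<close>

text \<open>
  A finite simplicial complex is given by its combinatorial data on vertices in \<open>nat\<close> (the set of
  its nonempty simplexes, as vertex sets) and realized geometrically in barycentric coordinates.
  Every finite simplicial complex, of whatever dimension, arises in this way up to simplicial
  homeomorphism. The library's \<open>simplicial_complex\<close> lives in one fixed Euclidean type, hence in
  bounded dimension.
\<close>

definition finite_complex :: "nat set set \<Rightarrow> bool" where
  "finite_complex K \<longleftrightarrow>
     finite K \<and> (\<forall>s\<in>K. finite s \<and> s \<noteq> {}) \<and> (\<forall>s\<in>K. \<forall>t. t \<noteq> {} \<and> t \<subseteq> s \<longrightarrow> t \<in> K)"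

definition closed_simplex :: "nat set \<Rightarrow> (nat \<Rightarrow> real) set" where
  "closed_simplex s = {a. (\<forall>i. 0 \<le> a i) \<and> (\<forall>i. i \<notin> s \<longrightarrow> a i = 0) \<and> (\<Sum>i\<in>s. a i) = 1}"

definition realization :: "nat set set \<Rightarrow> (nat \<Rightarrow> real) topology" where
  "realization K = subtopology (powertop_real UNIV) (\<Union>s\<in>K. closed_simplex s)"

definition local_dim :: "nat set set \<Rightarrow> (nat \<Rightarrow> real) \<Rightarrow> nat" where
  "local_dim K a = Max ((\<lambda>s. card s - 1) ` {s \<in> K. a \<in> closed_simplex s})"

definition eps_embedding ::
  "'a topology \<Rightarrow> ('a \<Rightarrow> 'a \<Rightarrow> real) \<Rightarrow> real \<Rightarrow> 'b topology \<Rightarrow> ('a \<Rightarrow> 'b) \<Rightarrow> bool" where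
  "eps_embedding X d \<epsilon> Y f \<longleftrightarrow>
     continuous_map X Y f \<and>
     (\<forall>y\<in>topspace Y. diam d {x \<in> topspace X. f x = y} < ereal \<epsilon>)"

text \<open>
  The inner supremum is a maximum: \<open>local_dim K\<close> is upper semicontinuous and \<open>X\<close> is compact.
\<close>

definition widim ::
  "'a topology \<Rightarrow> ('a \<Rightarrow> 'a \<Rightarrow> real) \<Rightarrow> real \<Rightarrow> ('a \<Rightarrow> real) \<Rightarrow> ereal" where
  "widim X d \<epsilon> \<psi> =
     (INF (K, f)\<in>{(K, f). finite_complex K \<and> eps_embedding X d \<epsilon> (realization K) f}.
        SUP x\<in>topspace X. ereal (real (local_dim K (f x)) + \<psi> x))"

definition mdim ::
  "'a topology \<Rightarrow> ('a \<Rightarrow> 'a) \<Rightarrow> ('a \<Rightarrow> 'a \<Rightarrow> real) \<Rightarrow> (nat \<Rightarrow> 'a \<Rightarrow> real) \<Rightarrow> ereal" where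
  "mdim X T d \<phi> =
     Lim (at_right 0)
       (\<lambda>\<epsilon>. lim (\<lambda>N. widim X (dyn_metric T d N) \<epsilon> (\<phi> N) / ereal (real N)))"


section \<open>Upper metric mean dimension\<close>

definition covering_number :: "'a topology \<Rightarrow> ('a \<Rightarrow> 'a \<Rightarrow> real) \<Rightarrow> real \<Rightarrow> nat" where
  "covering_number X d \<epsilon> =
     (LEAST k. \<exists>\<U>. finite \<U> \<and> card \<U> = k \<and> topspace X \<subseteq> \<Union>\<U> \<and>
                 (\<forall>U\<in>\<U>. openin X U \<and> diam d U < ereal \<epsilon>))"

definition upper_metric_mdim ::
  "'a topology \<Rightarrow> ('a \<Rightarrow> 'a) \<Rightarrow> ('a \<Rightarrow> 'a \<Rightarrow> real) \<Rightarrow> ereal" where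
  "upper_metric_mdim X T d =
     Limsup (at_right 0)
       (\<lambda>\<epsilon>. lim (\<lambda>N. ereal (ln (real (covering_number X (dyn_metric T d N) \<epsilon>)) / real N))
             / ereal (ln (1 / \<epsilon>)))"


section \<open>Rate distortion dimension\<close>

text \<open>Entropy (in nats) of a random variable with finitely many values.\<close>

definition shannon_entropy :: "'w measure \<Rightarrow> ('w \<Rightarrow> 'b) \<Rightarrow> real" where
  "shannon_entropy P Z = prob_space.entropy P (exp 1) (count_space (Z ` space P)) Z"

lemma shannon_entropy_eq:
  assumes "prob_space P" and "simple_function P Z"
  shows "shannon_entropy P Z =
    - (\<Sum>z\<in>Z ` space P. measure P (Z -` {z} \<inter> space P) * ln (measure P (Z -` {z} \<inter> space P)))"
proof -
  interpret prob_space P by fact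
  interpret information_space P "exp 1"
    by unfold_locales simp
  have "simple_distributed P Z (\<lambda>z. measure P (Z -` {z} \<inter> space P))"
    using assms(2) by (rule simple_distributedI) auto
  from entropy_simple_distributed[OF this] show ?thesis
    by (simp add: shannon_entropy_def log_def)
qed

text \<open>
  Mutual information of \<open>Z\<close> with values in \<open>S\<close> and \<open>Y\<close> with values in \<open>R\<close>, as a supremum over
  measurable finite-range quantizations (the values can be relabelled by natural numbers).
\<close>

definition mutual_info ::
  "'w measure \<Rightarrow> 'b measure \<Rightarrow> 'c measure \<Rightarrow> ('w \<Rightarrow> 'b) \<Rightarrow> ('w \<Rightarrow> 'c) \<Rightarrow> ereal" where
  "mutual_info P S R Z Y =
     (SUP (f, g)\<in>{(f :: 'b \<Rightarrow> nat, g :: 'c \<Rightarrow> nat). simple_function S f \<and> simple_function R g}.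
        ereal (shannon_entropy P (f \<circ> Z) + shannon_entropy P (g \<circ> Y)
               - shannon_entropy P (\<lambda>\<omega>. ((f \<circ> Z) \<omega>, (g \<circ> Y) \<omega>))))"

text \<open>
  \<open>I(Z; Y)\<close> and the distortion depend only on the joint law of \<open>(Z, Y)\<close>. Every joint law is
  carried by the underlying type \<open>'a \<times> (nat \<Rightarrow> 'a)\<close>, so probability spaces on this type suffice.
  The distortion is a bounded measurable function, hence integrable.
\<close>

definition rate_distortion ::
  "'a topology \<Rightarrow> ('a \<Rightarrow> 'a) \<Rightarrow> ('a \<Rightarrow> 'a \<Rightarrow> real) \<Rightarrow> 'a measure \<Rightarrow> real \<Rightarrow> ereal" where
  "rate_distortion X T d \<mu> \<epsilon> =
     (INF (n, P, Z, Y)\<in>{(n :: nat, P :: ('a \<times> (nat \<Rightarrow> 'a)) measure, Z, Y).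
          1 \<le> n \<and> prob_space P \<and>
          Z \<in> measurable P (borel_algebra X) \<and> distr P (borel_algebra X) Z = \<mu> \<and>
          (\<forall>k<n. Y k \<in> measurable P (borel_algebra X)) \<and>
          (LINT \<omega>|P. 1 / real n * (\<Sum>k<n. d ((T ^^ k) (Z \<omega>)) (Y k \<omega>))) < \<epsilon>}.
        mutual_info P (borel_algebra X) (PiM {..<n} (\<lambda>_. borel_algebra X))
            Z (\<lambda>\<omega>. \<lambda>k\<in>{..<n}. Y k \<omega>)
          / ereal (real n))"

definition upper_rdim ::
  "'a topology \<Rightarrow> ('a \<Rightarrow> 'a) \<Rightarrow> ('a \<Rightarrow> 'a \<Rightarrow> real) \<Rightarrow> 'a measure \<Rightarrow> ereal" where
  "upper_rdim X T d \<mu> =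
     Limsup (at_right 0) (\<lambda>\<epsilon>. rate_distortion X T d \<mu> \<epsilon> / ereal (ln (1 / \<epsilon>)))"

definition lower_rdim ::
  "'a topology \<Rightarrow> ('a \<Rightarrow> 'a) \<Rightarrow> ('a \<Rightarrow> 'a \<Rightarrow> real) \<Rightarrow> 'a measure \<Rightarrow> ereal" where
  "lower_rdim X T d \<mu> =
     Liminf (at_right 0) (\<lambda>\<epsilon>. rate_distortion X T d \<mu> \<epsilon> / ereal (ln (1 / \<epsilon>)))"

text \<open>\<open>m\<close> is the minimum of \<open>F\<close> over \<open>A\<close>; in particular it is attained.\<close>

definition is_minimum :: "'b::linorder \<Rightarrow> ('c \<Rightarrow> 'b) \<Rightarrow> 'c set \<Rightarrow> bool" where
  "is_minimum m F A \<longleftrightarrow> (\<exists>a\<in>A. F a = m) \<and> (\<forall>a\<in>A. m \<le> F a)"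

end

theory Submission
  imports Defs
begin

text \<open>
  The growth condition is imposed on every compatible metric, and this forces \<open>T\<close> to have finite
  topological entropy. Write \<open>S d \<epsilon>\<close> for the exponential growth rate in \<open>N\<close> of the number of sets of
  \<open>dyn_metric T d N\<close>-diameter below \<open>\<epsilon>\<close> that are needed to cover \<open>X\<close>. If \<open>S d\<close> were unbounded,
  choose scales \<open>e k\<close> with \<open>S d (e k) > k\<^sup>2\<close>. The metric \<open>sup\<^sub>k 2\<^sup>-\<^sup>k min(1, d / e k)\<close> induces the same
  topology, and a distance below \<open>2\<^sup>-\<^sup>k\<close> in it means a \<open>d\<close>-distance below \<open>e k\<close>. So its growth rate at
  scale \<open>2\<^sup>-\<^sup>k\<close> exceeds \<open>k\<^sup>2\<close>, and its upper metric mean dimension is infinite, a contradiction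
  (\<open>stretched_compatible\<close>, \<open>covering_number_stretched_ge\<close>, \<open>finite_entropy\<close>).

  Finite entropy makes the metric disappear from the right-hand sides. The rate distortion function
  at scale \<open>\<epsilon>\<close> is at most the growth rate of the coverings, hence bounded as \<open>\<epsilon> \<rightarrow> 0\<close>, and both rate
  distortion dimensions vanish for every compatible metric and every invariant measure
  (\<open>rdim_eq_0\<close>). The two functionals to be minimized are therefore constant in \<open>d\<close>, with value the
  supremum of the potential averages. For nonempty \<open>X\<close>, this value and the mean dimension are both equal to
  \<open>\<Phi> = lim (max \<phi>\<^sub>n) / n\<close>:

  \<^item> For the mean dimension (\<open>mdim_eq\<close>), \<open>\<Phi>\<close> is a lower bound because local dimensions are
    nonnegative. For the upper bound one embeds \<open>X\<close> with the \<open>N\<close>th Bowen metric into a complex of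
    dimension at most \<open>\<delta> N\<close> (\<open>low_dimensional_embedding\<close>). Use the coordinates \<open>(n, s)\<close>, with \<open>n < N\<close>
    and \<open>s\<close> in a finite net, each a cutoff function of the distance of \<open>T\<^sup>n x\<close> to \<open>s\<close> that is
    fractional only on a thin annulus, whose radius is chosen among \<open>m\<close> disjoint possibilities. A
    set of small diameter meets at most two annuli per coordinate, and exponentially many sets with
    an exponent independent of \<open>m\<close> cover \<open>X\<close>. A counting argument for large \<open>m\<close> gives radii for
    which no point has more than \<open>\<delta> N\<close> fractional coordinates (\<open>thresholds_exist\<close>), and the map then
    lands in a skeleton of the cube of that dimension (\<open>map_to_skeleton\<close>).

  \<^item> For the potential averages (\<open>sup_potential_average\<close>), \<open>\<Phi>\<close> is an upper bound because integrals
    are below maxima. It is attained by a weak limit of empirical measures along orbits on which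
    \<open>\<phi>\<^sub>n\<close> is nearly maximal (\<open>empirical_limit\<close>), since \<open>\<phi>\<^sub>n\<close> is controlled from above by Birkhoff sums
    of each \<open>\<phi>\<^sub>m\<close> (\<open>birkhoff_bound\<close>). Weak limits come from Helly's selection theorem on the line, by
    presenting \<open>X\<close> as a continuous image of a compact set of reals (\<open>real_coding\<close>).
\<close>

section \<open>Fekete's lemma\<close>

text \<open>
  Divide \<open>n = q m + r\<close> for an \<open>m\<close> whose quotient \<open>a m / m\<close> is almost the infimum: subadditivity bounds
  \<open>a n / n\<close> by that quotient up to an error of order \<open>1 / n\<close>.
\<close>

lemma fekete:
  fixes a :: "nat \<Rightarrow> real"
  assumes sub: "\<And>n m. n \<ge> 1 \<Longrightarrow> m \<ge> 1 \<Longrightarrow> a (n + m) \<le> a n + a m"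
    and low: "\<And>n. n \<ge> 1 \<Longrightarrow> B * real n \<le> a n"
  obtains L where "(\<lambda>n. a n / real n) \<longlonglongrightarrow> L" and "\<And>n. n \<ge> 1 \<Longrightarrow> L \<le> a n / real n"
proof -
  define L where "L = (INF n\<in>{1..}. a n / real n)"
  have bdd: "bdd_below ((\<lambda>n. a n / real n) ` {1..})"
    by (rule bdd_belowI2[of _ B]) (use low in \<open>auto simp: field_simps\<close>)
  have lower: "L \<le> a n / real n" if "n \<ge> 1" for n
    unfolding L_def by (rule cINF_lower[OF bdd]) (use that in auto)
  have "(\<lambda>n. a n / real n) \<longlonglongrightarrow> L"
  proof (rule LIMSEQ_I)
    fix e :: real assume e: "e > 0"
    have "\<exists>m\<in>{1..}. a m / real m < L + e / 2"
      unfolding L_def using e bdd by (subst cINF_less_iff[symmetric]) auto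
    then obtain m where m: "m \<ge> 1" "a m / real m < L + e / 2" by auto
    \<comment> \<open>index \<open>0\<close> is not subject to the hypotheses, but occurs as a remainder\<close>
    define b where "b n = (if n = 0 then 0 else a n)" for n
    have bsub: "b (n + k) \<le> b n + b k" for n k
      unfolding b_def using sub[of n k] by auto
    have bmult: "b (q * m + r) \<le> real q * b m + b r" for q r
    proof (induction q)
      case (Suc q)
      have "b (Suc q * m + r) \<le> b m + b (q * m + r)"
        using bsub[of m "q * m + r"] by (simp add: algebra_simps)
      with Suc show ?case by (simp add: algebra_simps)
    qed simp
    \<comment> \<open>bounds the remainder block and the part of \<open>a m\<close> lost to \<open>r < m\<close>\<close>
    define C where "C = (\<Sum>r<m. \<bar>b r\<bar>) + \<bar>a m\<bar>"
    have upper: "a n / real n \<le> a m / real m + C / real n" if n: "n \<ge> 1" for n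
    proof -
      define q r where "q = n div m" and "r = n mod m"
      have nq: "n = q * m + r" and r: "r < m" using m by (auto simp: q_def r_def)
      have "b r \<le> (\<Sum>r<m. \<bar>b r\<bar>)"
        using member_le_sum[of r "{..<m}" "\<lambda>r. \<bar>b r\<bar>"] r by auto
      moreover have "a n \<le> real q * a m + b r"
        using bmult[of q r] n m unfolding nq[symmetric] by (simp add: b_def)
      moreover have "real q * a m = (a m / real m) * real n - (a m / real m) * real r"
        using m by (simp add: nq field_simps)
      moreover have "- ((a m / real m) * real r) \<le> \<bar>a m\<bar>"
      proof -
        have "\<bar>(a m / real m) * real r\<bar> = \<bar>a m\<bar> * (real r / real m)" using m by (simp add: abs_mult)
        also have "\<dots> \<le> \<bar>a m\<bar> * 1" using r by (intro mult_left_mono) auto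
        finally show ?thesis by linarith
      qed
      ultimately have "a n \<le> (a m / real m) * real n + C" unfolding C_def by linarith
      then show ?thesis using n by (simp add: field_simps)
    qed
    have "(\<lambda>n. C / real n) \<longlonglongrightarrow> 0" by (rule lim_const_over_n)
    then have "\<forall>\<^sub>F n in sequentially. C / real n < e / 2"
      by (rule order_tendstoD) (use e in auto)
    then obtain N where N: "\<And>n. n \<ge> N \<Longrightarrow> C / real n < e / 2"
      by (auto simp: eventually_sequentially)
    show "\<exists>no. \<forall>n\<ge>no. norm (a n / real n - L) < e"
    proof (intro exI[of _ "max N 1"] allI impI)
      fix n assume "n \<ge> max N 1"
      then have n: "n \<ge> 1" "n \<ge> N" by auto
      have "a n / real n < L + e" using upper[OF n(1)] N[OF n(2)] m(2) by linarith
      then show "norm (a n / real n - L) < e" using lower[OF n(1)] e by simp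
    qed
  qed
  then show ?thesis using lower that by blast
qed

section \<open>Bowen metrics and coverings\<close>

lemma dyn_metric_le_iff:
  assumes "N \<ge> 1"
  shows "dyn_metric T d N x y \<le> r \<longleftrightarrow> (\<forall>n<N. d ((T ^^ n) x) ((T ^^ n) y) \<le> r)"
proof -
  have "{..<N} \<noteq> {}" using assms by (auto simp: lessThan_empty_iff)
  then show ?thesis unfolding dyn_metric_def by (subst Max_le_iff) auto
qed

lemma dyn_metric_ge:
  assumes "n < N"
  shows "d ((T ^^ n) x) ((T ^^ n) y) \<le> dyn_metric T d N x y"
  using dyn_metric_le_iff[of N T d x y "dyn_metric T d N x y"] assms by auto

lemma diam_le_iff:
  assumes "0 \<le> r"
  shows "diam d S \<le> ereal r \<longleftrightarrow> (\<forall>x\<in>S. \<forall>y\<in>S. d x y \<le> r)"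
  using assms by (auto simp: diam_def SUP_le_iff)

text \<open>
  A strict bound on the supremum of the distances leaves room for a real number \<open>r\<close> in between; all
  later diameter estimates are made with such an \<open>r\<close>.
\<close>

lemma diam_less_iff:
  assumes "0 < \<epsilon>"
  shows "diam d S < ereal \<epsilon> \<longleftrightarrow> (\<exists>r. 0 \<le> r \<and> r < \<epsilon> \<and> (\<forall>x\<in>S. \<forall>y\<in>S. d x y \<le> r))"
    (is "?L \<longleftrightarrow> ?R")
proof
  assume ?L
  then obtain r where r: "diam d S < ereal r" "ereal r < ereal \<epsilon>"
    using ereal_dense2 by blast
  then have "diam d S \<le> ereal (max r 0)" "max r 0 < \<epsilon>"
    using assms order.strict_trans2[of "diam d S" "ereal r" "ereal (max r 0)"] by auto
  then show ?R by (subst (asm) diam_le_iff) (auto intro!: exI[of _ "max r 0"])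
next
  assume ?R
  then obtain r where "0 \<le> r" "r < \<epsilon>" "diam d S \<le> ereal r" by (auto simp: diam_le_iff)
  then show ?L by (meson ereal_less(2) le_less_trans ereal_less_eq(3) not_less less_ereal.simps(1))
qed

definition metric_cover :: "'a topology \<Rightarrow> ('a \<Rightarrow> 'a \<Rightarrow> real) \<Rightarrow> real \<Rightarrow> 'a set set \<Rightarrow> bool" where
  "metric_cover X d \<epsilon> \<U> \<longleftrightarrow> finite \<U> \<and> topspace X \<subseteq> \<Union>\<U> \<and>
     (\<forall>U\<in>\<U>. openin X U \<and> diam d U < ereal \<epsilon>)"

lemma covering_number_le:
  assumes "metric_cover X d \<epsilon> \<U>"
  shows "covering_number X d \<epsilon> \<le> card \<U>"
  unfolding covering_number_def
  by (rule Least_le) (use assms in \<open>auto simp: metric_cover_def\<close>)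

lemma covering_number_attained:
  assumes "metric_cover X d \<epsilon> \<U>"
  obtains \<V> where "metric_cover X d \<epsilon> \<V>" and "card \<V> = covering_number X d \<epsilon>"
proof -
  have "\<exists>\<V>. finite \<V> \<and> card \<V> = covering_number X d \<epsilon> \<and> topspace X \<subseteq> \<Union>\<V> \<and>
     (\<forall>U\<in>\<V>. openin X U \<and> diam d U < ereal \<epsilon>)"
    unfolding covering_number_def
    by (rule LeastI_ex) (use assms in \<open>auto simp: metric_cover_def\<close>)
  then show ?thesis using that unfolding metric_cover_def by blast
qed

locale compact_system =
  fixes X :: "'a topology" and T :: "'a \<Rightarrow> 'a" and d :: "'a \<Rightarrow> 'a \<Rightarrow> real"
  assumes compact: "compact_space X"
    and cont: "continuous_map X X T"
    and compat: "d \<in> compatible_metrics X"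
begin

lemma metric: "Metric_space (topspace X) d"
  and mtop: "Metric_space.mtopology (topspace X) d = X"
  using compat by (auto simp: compatible_metrics_def)

sublocale M: Metric_space "topspace X" d by (rule metric)

lemma cont_iter: "continuous_map X X (T ^^ n)"
proof (induction n)
  case 0
  show ?case using continuous_map_id by (simp add: id_def)
next
  case (Suc n)
  show ?case using continuous_map_compose[OF Suc cont] by (simp add: comp_def)
qed

lemma iter_in: "x \<in> topspace X \<Longrightarrow> (T ^^ n) x \<in> topspace X"
  using cont_iter[of n] by (auto simp: continuous_map_def)

lemma open_ball: "openin X (M.mball x r)"
  using M.openin_mball[of x r] by (simp add: mtop)

lemma open_dyn_ball:
  "openin X {y \<in> topspace X. \<forall>n<N. (T ^^ n) y \<in> M.mball ((T ^^ n) x) r}"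
proof (induction N)
  case (Suc N)
  have "openin X {y \<in> topspace X. (T ^^ N) y \<in> M.mball ((T ^^ N) x) r}"
    by (rule openin_continuous_map_preimage[OF cont_iter open_ball])
  from openin_Int[OF Suc this] show ?case
    by (rule back_subst[of "openin X"]) (auto simp: less_Suc_eq)
qed auto

lemma metric_cover_exists:
  assumes N: "N \<ge> 1" and \<epsilon>: "\<epsilon> > 0"
  shows "\<exists>\<U>. metric_cover X (dyn_metric T d N) \<epsilon> \<U>"
proof -
  define B where "B x = {y \<in> topspace X. \<forall>n<N. (T ^^ n) y \<in> M.mball ((T ^^ n) x) (\<epsilon> / 3)}" for x
  have cov: "topspace X \<subseteq> \<Union>(B ` topspace X)"
    using \<epsilon> iter_in by (fastforce simp: B_def)
  obtain \<F> where \<F>: "finite \<F>" "\<F> \<subseteq> B ` topspace X" "topspace X \<subseteq> \<Union>\<F>"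
  proof -
    have "openin X U" if "U \<in> B ` topspace X" for U
      using that open_dyn_ball by (force simp only: B_def image_iff)
    then have "\<exists>\<F>. finite \<F> \<and> \<F> \<subseteq> B ` topspace X \<and> topspace X \<subseteq> \<Union>\<F>"
      using cov compact[unfolded compact_space_alt, rule_format, of "B ` topspace X"] by simp
    then show ?thesis using that by metis
  qed
  have "diam (dyn_metric T d N) (B x) < ereal \<epsilon>" if "x \<in> topspace X" for x
    unfolding diam_less_iff[OF \<epsilon>]
  proof (intro exI[of _ "2 * \<epsilon> / 3"] conjI ballI)
    fix y z assume y: "y \<in> B x" and z: "z \<in> B x"
    have "d ((T ^^ n) y) ((T ^^ n) z) \<le> 2 * \<epsilon> / 3" if n: "n < N" for n
    proof -
      have "d ((T ^^ n) y) ((T ^^ n) z) \<le> d ((T ^^ n) y) ((T ^^ n) x) + d ((T ^^ n) x) ((T ^^ n) z)"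
        using y z n unfolding B_def by (intro M.triangle) auto
      also have "\<dots> \<le> \<epsilon> / 3 + \<epsilon> / 3"
        using y z n M.commute unfolding B_def by (intro add_mono) (auto simp: less_imp_le)
      finally show ?thesis by simp
    qed
    then show "dyn_metric T d N y z \<le> 2 * \<epsilon> / 3" by (subst dyn_metric_le_iff[OF N]) blast
  qed (use \<epsilon> in auto)
  then have "metric_cover X (dyn_metric T d N) \<epsilon> \<F>"
    using \<F> open_dyn_ball unfolding metric_cover_def B_def by blast
  then show ?thesis ..
qed

text \<open>
  Intersecting a set for the first \<open>N\<close> times with the pullback under \<open>T\<^sup>N\<close> of a set for the next \<open>K\<close>
  times keeps the diameter small at all \<open>N + K\<close> times. This is what makes the growth rates exist.
\<close>

lemma covering_number_submult:
  assumes N: "N \<ge> 1" and K: "K \<ge> 1" and \<epsilon>: "\<epsilon> > 0"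
  shows "covering_number X (dyn_metric T d (N + K)) \<epsilon> \<le>
         covering_number X (dyn_metric T d N) \<epsilon> * covering_number X (dyn_metric T d K) \<epsilon>"
proof -
  obtain \<U> where \<U>: "metric_cover X (dyn_metric T d N) \<epsilon> \<U>"
    "card \<U> = covering_number X (dyn_metric T d N) \<epsilon>"
    using covering_number_attained metric_cover_exists[OF N \<epsilon>] by metis
  obtain \<V> where \<V>: "metric_cover X (dyn_metric T d K) \<epsilon> \<V>"
    "card \<V> = covering_number X (dyn_metric T d K) \<epsilon>"
    using covering_number_attained metric_cover_exists[OF K \<epsilon>] by metis
  define W where "W = (\<lambda>(U, V). U \<inter> {x \<in> topspace X. (T ^^ N) x \<in> V})"
  have "metric_cover X (dyn_metric T d (N + K)) \<epsilon> (W ` (\<U> \<times> \<V>))"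
    unfolding metric_cover_def
  proof (intro conjI ballI)
    show "finite (W ` (\<U> \<times> \<V>))" using \<U> \<V> by (auto simp: metric_cover_def)
    show "topspace X \<subseteq> \<Union>(W ` (\<U> \<times> \<V>))"
    proof
      fix x assume x: "x \<in> topspace X"
      then obtain U V where "x \<in> U" "U \<in> \<U>" "(T ^^ N) x \<in> V" "V \<in> \<V>"
        using \<U> \<V> iter_in[OF x, of N] unfolding metric_cover_def by (metis UnionE subsetD)
      then show "x \<in> \<Union>(W ` (\<U> \<times> \<V>))" using x by (force simp: W_def)
    qed
    fix S assume "S \<in> W ` (\<U> \<times> \<V>)"
    then obtain U V where S: "S = U \<inter> {x \<in> topspace X. (T ^^ N) x \<in> V}" "U \<in> \<U>" "V \<in> \<V>"
      by (auto simp: W_def)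
    show "openin X S" unfolding S
      using S \<U> \<V> openin_continuous_map_preimage[OF cont_iter[of N], of V]
      by (auto simp: metric_cover_def)
    obtain r where r: "0 \<le> r" "r < \<epsilon>" "\<forall>x\<in>U. \<forall>y\<in>U. dyn_metric T d N x y \<le> r"
      using S \<U> by (auto simp: metric_cover_def diam_less_iff[OF \<epsilon>])
    obtain s where s: "0 \<le> s" "s < \<epsilon>" "\<forall>x\<in>V. \<forall>y\<in>V. dyn_metric T d K x y \<le> s"
      using S \<V> by (auto simp: metric_cover_def diam_less_iff[OF \<epsilon>])
    show "diam (dyn_metric T d (N + K)) S < ereal \<epsilon>"
      unfolding diam_less_iff[OF \<epsilon>]
    proof (intro exI[of _ "max r s"] conjI ballI)
      fix x y assume xy: "x \<in> S" "y \<in> S"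
      have "d ((T ^^ n) x) ((T ^^ n) y) \<le> max r s" if n: "n < N + K" for n
      proof (cases "n < N")
        case True
        then show ?thesis using r xy dyn_metric_ge[OF True, of d T x y] by (force simp: S)
      next
        case False
        define m where "m = n - N"
        have m: "n = m + N" "m < K" using False n by (auto simp: m_def)
        show ?thesis
          using s xy dyn_metric_ge[OF m(2), of d T "(T ^^ N) x" "(T ^^ N) y"]
          by (force simp: S m(1) funpow_add)
      qed
      then show "dyn_metric T d (N + K) x y \<le> max r s"
        using N by (subst dyn_metric_le_iff) auto
    qed (use r s in auto)
  qed
  then have "covering_number X (dyn_metric T d (N + K)) \<epsilon> \<le> card (W ` (\<U> \<times> \<V>))"
    by (rule covering_number_le)
  also have "\<dots> \<le> card (\<U> \<times> \<V>)"
    using \<U> \<V> by (intro card_image_le) (auto simp: metric_cover_def)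
  finally show ?thesis using \<U> \<V> by (simp add: card_cartesian_product)
qed

lemma covering_number_pos:
  assumes "N \<ge> 1" "\<epsilon> > 0" "topspace X \<noteq> {}"
  shows "covering_number X (dyn_metric T d N) \<epsilon> \<ge> 1"
proof -
  obtain \<U> where "metric_cover X (dyn_metric T d N) \<epsilon> \<U>"
    "card \<U> = covering_number X (dyn_metric T d N) \<epsilon>"
    using covering_number_attained metric_cover_exists[OF assms(1,2)] by metis
  moreover from this have "finite \<U>" "\<U> \<noteq> {}" using assms by (auto simp: metric_cover_def)
  ultimately show ?thesis by (metis One_nat_def Suc_leI card_gt_0_iff)
qed

lemma covering_growth:
  assumes \<epsilon>: "\<epsilon> > 0" and ne: "topspace X \<noteq> {}"
  obtains L where
    "(\<lambda>N. ln (real (covering_number X (dyn_metric T d N) \<epsilon>)) / real N) \<longlonglongrightarrow> L"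
proof (rule fekete[of "\<lambda>N. ln (real (covering_number X (dyn_metric T d N) \<epsilon>))" 0])
  fix n m :: nat assume nm: "n \<ge> 1" "m \<ge> 1"
  let ?c = "\<lambda>N. covering_number X (dyn_metric T d N) \<epsilon>"
  have pos: "?c n \<ge> 1" "?c m \<ge> 1" "?c (n + m) \<ge> 1"
    using nm covering_number_pos[OF _ \<epsilon> ne] by auto
  have "real (?c (n + m)) \<le> real (?c n * ?c m)" "0 < real (?c (n + m))"
    using covering_number_submult[OF nm \<epsilon>] pos by (auto simp flip: of_nat_mult)
  then have "ln (real (?c (n + m))) \<le> ln (real (?c n * ?c m))" by simp
  also have "\<dots> = ln (real (?c n)) + ln (real (?c m))" using pos by (simp add: ln_mult)
  finally show "ln (real (?c (n + m))) \<le> ln (real (?c n)) + ln (real (?c m))" .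
next
  fix n :: nat
  show "0 * real n \<le> ln (real (covering_number X (dyn_metric T d n) \<epsilon>))"
    by (cases "covering_number X (dyn_metric T d n) \<epsilon>") auto
qed (use that in auto)

end

section \<open>Finite entropy\<close>

lemma mtopology_eqI:
  assumes "Metric_space M d" "Metric_space M d'"
    and 1: "\<And>x r. x \<in> M \<Longrightarrow> r > 0 \<Longrightarrow> \<exists>s>0. \<forall>y\<in>M. d x y < s \<longrightarrow> d' x y < r"
    and 2: "\<And>x r. x \<in> M \<Longrightarrow> r > 0 \<Longrightarrow> \<exists>s>0. \<forall>y\<in>M. d' x y < s \<longrightarrow> d x y < r"
  shows "Metric_space.mtopology M d = Metric_space.mtopology M d'"
proof -
  interpret A: Metric_space M d by fact
  interpret B: Metric_space M d' by fact
  have "(\<exists>r>0. A.mball x r \<subseteq> U) \<longleftrightarrow> (\<exists>r>0. B.mball x r \<subseteq> U)" if x: "x \<in> M" for x U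
  proof
    assume "\<exists>r>0. A.mball x r \<subseteq> U"
    then obtain r where r: "r > 0" "A.mball x r \<subseteq> U" by blast
    obtain s where "s > 0" "\<forall>y\<in>M. d' x y < s \<longrightarrow> d x y < r" using 2[OF x r(1)] by blast
    then show "\<exists>r>0. B.mball x r \<subseteq> U" using r by (intro exI[of _ s]) auto
  next
    assume "\<exists>r>0. B.mball x r \<subseteq> U"
    then obtain r where r: "r > 0" "B.mball x r \<subseteq> U" by blast
    obtain s where "s > 0" "\<forall>y\<in>M. d x y < s \<longrightarrow> d' x y < r" using 1[OF x r(1)] by blast
    then show "\<exists>r>0. A.mball x r \<subseteq> U" using r by (intro exI[of _ s]) auto
  qed
  then show ?thesis
    unfolding topology_eq A.openin_mtopology B.openin_mtopology by blast
qed

text \<open>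
  The supremum, unlike an infinite sum, needs no convergence argument, and keeps each scale \<open>e k\<close> visible
  as a lower bound.
\<close>

definition stretched :: "(nat \<Rightarrow> real) \<Rightarrow> ('a \<Rightarrow> 'a \<Rightarrow> real) \<Rightarrow> 'a \<Rightarrow> 'a \<Rightarrow> real" where
  "stretched e d x y = (SUP k. (1/2) ^ k * min 1 (d x y / e k))"

lemma stretched_term_bounds:
  assumes "e k > 0" "0 \<le> d x y"
  shows "0 \<le> (1/2) ^ k * min 1 (d x y / e k)" "(1/2) ^ k * min 1 (d x y / e k) \<le> (1/2 :: real) ^ k"
  using assms by (auto simp: mult_le_cancel_left1 min_def)

lemma stretched_ge:
  assumes "\<And>k. e k > 0" "0 \<le> d x y"
  shows "(1/2) ^ k * min 1 (d x y / e k) \<le> stretched e d x y"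
  unfolding stretched_def
proof (rule cSUP_upper)
  show "bdd_above (range (\<lambda>k. (1/2) ^ k * min 1 (d x y / e k)))"
    by (rule bdd_aboveI2[of _ _ 1])
      (rule order_trans[OF stretched_term_bounds(2)[of e _ d x y, OF assms]], simp add: power_le_one)
qed auto

text \<open>
  Each term is a truncated multiple of \<open>d\<close>, so the triangle inequality passes to the supremum. The
  terms with large index are uniformly small and the others are finitely many, which makes the new
  metric continuous for the old one; the term of index \<open>0\<close> alone gives the converse.
\<close>

lemma stretched_compatible:
  fixes e :: "nat \<Rightarrow> real"
  assumes d: "d \<in> compatible_metrics X" and e: "\<And>k. e k > 0"
  shows "stretched e d \<in> compatible_metrics X"
proof -
  interpret D: Metric_space "topspace X" d using d by (simp add: compatible_metrics_def)
  have ge: "(1/2) ^ k * min 1 (d x y / e k) \<le> stretched e d x y" for k x y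
    by (rule stretched_ge[of e d x y k, OF e D.nonneg])
  have le: "stretched e d x y \<le> b" if "\<And>k. (1/2) ^ k * min 1 (d x y / e k) \<le> b" for x y b
    unfolding stretched_def by (rule cSUP_least) (use that in auto)
  have nonneg: "0 \<le> stretched e d x y" for x y
    using ge[of 0 x y] stretched_term_bounds(1)[of e 0 d x y] e D.nonneg order_trans by blast
  have metric': "Metric_space (topspace X) (stretched e d)"
  proof
    fix x y z
    show "0 \<le> stretched e d x y" by (rule nonneg)
    show "stretched e d x y = stretched e d y x" unfolding stretched_def by (simp add: D.commute)
    assume x: "x \<in> topspace X" and y: "y \<in> topspace X"
    show "stretched e d x y = 0 \<longleftrightarrow> x = y"
    proof
      assume "stretched e d x y = 0"
      then have "min 1 (d x y / e 0) \<le> 0" using ge[of 0 x y] by simp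
      then have "d x y \<le> 0" using e[of 0] by (auto simp: min_def divide_le_0_iff split: if_splits)
      then show "x = y" using D.nonneg[of x y] D.zero[OF x y] by linarith
    next
      assume "x = y"
      then have "d x y = 0" using D.zero[OF x y] by simp
      then show "stretched e d x y = 0" unfolding stretched_def by simp
    qed
    assume z: "z \<in> topspace X"
    show "stretched e d x z \<le> stretched e d x y + stretched e d y z"
    proof (rule le)
      fix k
      have "d x z / e k \<le> d x y / e k + d y z / e k"
        using D.triangle[OF x y z] e[of k] by (simp add: field_simps)
      moreover have "0 \<le> d x y / e k" "0 \<le> d y z / e k" using e[of k] D.nonneg by (auto intro: divide_nonneg_pos)
      ultimately have "min 1 (d x z / e k) \<le> min 1 (d x y / e k) + min 1 (d y z / e k)"
        by (auto simp: min_def)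
      then have "(1/2) ^ k * min 1 (d x z / e k)
          \<le> (1/2) ^ k * min 1 (d x y / e k) + (1/2) ^ k * min 1 (d y z / e k)"
        by (simp flip: distrib_left)
      also have "\<dots> \<le> stretched e d x y + stretched e d y z" by (intro add_mono ge)
      finally show "(1/2) ^ k * min 1 (d x z / e k) \<le> stretched e d x y + stretched e d y z" .
    qed
  qed
  have "Metric_space.mtopology (topspace X) d = Metric_space.mtopology (topspace X) (stretched e d)"
  proof (rule mtopology_eqI[OF D.Metric_space_axioms metric'])
    fix x and r :: real assume x: "x \<in> topspace X" and r: "r > 0"
    obtain k\<^sub>0 where k0: "(1/2 :: real) ^ k\<^sub>0 < r"
      using real_arch_pow_inv[OF r, of "1/2"] by auto
    define s where "s = Min ((\<lambda>k. e k * (r / 2)) ` {..k\<^sub>0})"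
    have s: "s > 0" unfolding s_def using e r by (subst Min_gr_iff) auto
    show "\<exists>s>0. \<forall>y\<in>topspace X. d x y < s \<longrightarrow> stretched e d x y < r"
    proof (intro exI[of _ s] conjI ballI impI s)
      fix y assume y: "d x y < s"
      have "stretched e d x y \<le> max ((1/2) ^ k\<^sub>0) (r / 2)"
      proof (rule le)
        fix k
        show "(1/2) ^ k * min 1 (d x y / e k) \<le> max ((1/2) ^ k\<^sub>0) (r / 2)"
        proof (cases "k \<le> k\<^sub>0")
          case True
          then have "s \<le> e k * (r / 2)" unfolding s_def by (intro Min_le) auto
          then have "d x y / e k \<le> r / 2" using y e[of k] by (simp add: field_simps)
          then have "min 1 (d x y / e k) \<le> r / 2" by (rule min.coboundedI2)
          moreover have "0 \<le> min 1 (d x y / e k)" using e[of k] by simp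
          ultimately have "(1/2) ^ k * min 1 (d x y / e k) \<le> 1 * (r / 2)"
            by (intro mult_mono power_le_one) auto
          then show ?thesis unfolding mult_1 by (rule max.coboundedI2)
        next
          case False
          then have "(1/2 :: real) ^ k \<le> (1/2) ^ k\<^sub>0" by (intro power_decreasing) auto
          with stretched_term_bounds(2)[of e k d x y, OF e D.nonneg]
          have "(1/2) ^ k * min 1 (d x y / e k) \<le> (1/2) ^ k\<^sub>0" by (rule order_trans)
          then show ?thesis by (rule max.coboundedI1)
        qed
      qed
      then show "stretched e d x y < r" using k0 r by auto
    qed
  next
    fix x and r :: real assume x: "x \<in> topspace X" and r: "r > 0"
    show "\<exists>s>0. \<forall>y\<in>topspace X. stretched e d x y < s \<longrightarrow> d x y < r"
    proof (intro exI[of _ "min 1 (r / e 0)"] conjI ballI impI)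
      fix y assume "stretched e d x y < min 1 (r / e 0)"
      then have "min 1 (d x y / e 0) < min 1 (r / e 0)" using ge[of 0 x y] by simp
      then show "d x y < r" using e[of 0] by (auto simp: min_def field_simps split: if_splits)
    qed (use e[of 0] r in auto)
  qed
  then show ?thesis using metric' d by (auto simp: compatible_metrics_def)
qed

text \<open>
  A set of stretched diameter below \<open>2\<^sup>-\<^sup>k\<close> has \<open>d\<close>-diameter below \<open>e k\<close>, because the \<open>k\<close>th truncation is
  then not active.
\<close>

lemma covering_number_stretched_ge:
  assumes "compact_system X T d" and e: "\<And>k. e k > 0" and N: "N \<ge> 1"
  shows "covering_number X (dyn_metric T d N) (e k)
      \<le> covering_number X (dyn_metric T (stretched e d) N) ((1/2) ^ k)"
proof -
  interpret D: compact_system X T d by fact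
  interpret D': compact_system X T "stretched e d"
    using stretched_compatible[OF D.compat e] D.compact D.cont by unfold_locales auto
  obtain \<U> where \<U>: "metric_cover X (dyn_metric T (stretched e d) N) ((1/2) ^ k) \<U>"
    "card \<U> = covering_number X (dyn_metric T (stretched e d) N) ((1/2) ^ k)"
    using covering_number_attained D'.metric_cover_exists[OF N, of "(1/2) ^ k"] by (metis zero_less_power half_gt_zero zero_less_one)
  have "metric_cover X (dyn_metric T d N) (e k) \<U>"
    unfolding metric_cover_def
  proof (intro conjI ballI)
    fix U assume U: "U \<in> \<U>"
    obtain r where r: "0 \<le> r" "r < (1/2) ^ k"
        "\<forall>x\<in>U. \<forall>y\<in>U. dyn_metric T (stretched e d) N x y \<le> r"
      using \<U> U by (auto simp: metric_cover_def diam_less_iff)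
    show "diam (dyn_metric T d N) U < ereal (e k)"
      unfolding diam_less_iff[OF e]
    proof (intro exI[of _ "e k * (2 ^ k * r)"] conjI ballI)
      fix x y assume xy: "x \<in> U" "y \<in> U"
      show "dyn_metric T d N x y \<le> e k * (2 ^ k * r)"
        unfolding dyn_metric_le_iff[OF N]
      proof (intro allI impI)
        fix n assume n: "n < N"
        let ?d = "d ((T ^^ n) x) ((T ^^ n) y)"
        have "(1/2) ^ k * min 1 (?d / e k) \<le> stretched e d ((T ^^ n) x) ((T ^^ n) y)"
          by (rule stretched_ge[of e d "(T ^^ n) x" "(T ^^ n) y" k, OF e D.M.nonneg])
        also have "\<dots> \<le> dyn_metric T (stretched e d) N x y" by (rule dyn_metric_ge[OF n])
        also have "\<dots> \<le> r" using r xy by blast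
        finally have *: "min 1 (?d / e k) \<le> 2 ^ k * r" by (simp add: field_simps)
        moreover have "2 ^ k * r < 1" using r by (simp add: field_simps)
        ultimately have "?d / e k \<le> 2 ^ k * r" by (auto simp: min_def split: if_splits)
        then show "?d \<le> e k * (2 ^ k * r)" using e[of k] by (simp add: field_simps)
      qed
    qed (use r e[of k] in \<open>auto simp: field_simps\<close>)
  qed (use \<U> in \<open>auto simp: metric_cover_def\<close>)
  then show ?thesis using covering_number_le \<U> by metis
qed

text \<open>
  If the growth rates of \<open>d\<close> were unbounded, stretching \<open>d\<close> at scales where they exceed \<open>k\<^sup>2\<close> would
  beat the logarithm \<open>k ln 2\<close> of the scale \<open>2\<^sup>-\<^sup>k\<close>.
\<close>

lemma finite_entropy:
  assumes sys: "compact_system X T d" and ne: "topspace X \<noteq> {}"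
    and fin: "\<And>d'. d' \<in> compatible_metrics X \<Longrightarrow> upper_metric_mdim X T d' < \<infinity>"
  obtains h where "h \<ge> 0"
    and "\<And>\<epsilon>. \<epsilon> > 0 \<Longrightarrow>
      \<forall>\<^sub>F N in sequentially. ln (real (covering_number X (dyn_metric T d N) \<epsilon>)) \<le> h * real N"
proof -
  interpret D: compact_system X T d by fact
  define c where "c d \<epsilon> N = ln (real (covering_number X (dyn_metric T d N) \<epsilon>)) / real N"
    for d :: "'a \<Rightarrow> 'a \<Rightarrow> real" and \<epsilon> N
  define S where "S d \<epsilon> = lim (c d \<epsilon>)" for d :: "'a \<Rightarrow> 'a \<Rightarrow> real" and \<epsilon>
  have conv: "c d' \<epsilon> \<longlonglongrightarrow> S d' \<epsilon>" if d': "d' \<in> compatible_metrics X" and \<epsilon>: "\<epsilon> > 0" for d' \<epsilon>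
  proof -
    interpret D': compact_system X T d' using d' D.compact D.cont by unfold_locales
    obtain L where "c d' \<epsilon> \<longlonglongrightarrow> L" unfolding c_def using D'.covering_growth[OF \<epsilon> ne] .
    then show ?thesis unfolding S_def by (simp add: limI)
  qed
  have "\<exists>h. \<forall>\<epsilon>>0. S d \<epsilon> \<le> h"
  proof (rule ccontr)
    assume "\<not> (\<exists>h. \<forall>\<epsilon>>0. S d \<epsilon> \<le> h)"
    then have "\<forall>k::nat. \<exists>\<epsilon>>0. S d \<epsilon> > real k ^ 2" by (meson not_le)
    then obtain e where e: "\<And>k. e k > 0" and big: "\<And>k. S d (e k) > real k ^ 2" by metis
    define d' where "d' = stretched e d"
    have d': "d' \<in> compatible_metrics X"
      unfolding d'_def by (rule stretched_compatible[OF D.compat e])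
    have S': "real k ^ 2 \<le> S d' ((1/2) ^ k)" for k
    proof -
      have "S d (e k) \<le> S d' ((1/2) ^ k)"
      proof (rule LIMSEQ_le[OF conv[OF D.compat e] conv[OF d']])
        show "\<exists>N. \<forall>n\<ge>N. c d (e k) n \<le> c d' ((1/2) ^ k) n"
        proof (intro exI[of _ 1] allI impI)
          fix n :: nat assume n: "n \<ge> 1"
          show "c d (e k) n \<le> c d' ((1/2) ^ k) n"
            unfolding c_def d'_def
            using covering_number_stretched_ge[of X T d e n k, OF sys e n]
              D.covering_number_pos[of n "e k", OF n e ne]
            by (intro divide_right_mono) auto
        qed
      qed auto
      then show ?thesis using big[of k] by linarith
    qed
    have "upper_metric_mdim X T d' < \<infinity>" by (rule fin[OF d'])
    then obtain C :: nat where C: "upper_metric_mdim X T d' < ereal (real C)"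
      by (metis less_PInf_Ex_of_nat less_irrefl)
    have lim_eq: "lim (\<lambda>N. ereal (c d' \<epsilon> N)) = ereal (S d' \<epsilon>)" if "\<epsilon> > 0" for \<epsilon>
      using conv[OF d' that] by (intro limI) simp
    have "\<forall>\<^sub>F \<epsilon> in at_right 0.
        lim (\<lambda>N. ereal (c d' \<epsilon> N)) / ereal (ln (1 / \<epsilon>)) < ereal (real C)"
      using C unfolding upper_metric_mdim_def c_def by (rule Limsup_lessD)
    moreover have "filterlim (\<lambda>k::nat. (1/2::real) ^ k) (at_right 0) sequentially"
      unfolding filterlim_at by (auto intro!: LIMSEQ_realpow_zero)
    ultimately have "\<forall>\<^sub>F k in sequentially.
        lim (\<lambda>N. ereal (c d' ((1/2) ^ k) N)) / ereal (ln (1 / (1/2) ^ k)) < ereal (real C)"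
      by (rule eventually_compose_filterlim)
    then obtain k\<^sub>0 where k0: "\<And>k. k \<ge> k\<^sub>0 \<Longrightarrow>
        lim (\<lambda>N. ereal (c d' ((1/2) ^ k) N)) / ereal (ln (1 / (1/2) ^ k)) < ereal (real C)"
      by (auto simp: eventually_sequentially)
    define k where "k = k\<^sub>0 + C + 1"
    have ln2: "0 < ln (2::real)" "ln (2::real) \<le> 1" using ln_2_less_1 by auto
    have "ereal (S d' ((1/2) ^ k)) / ereal (real k * ln 2) < ereal (real C)"
    proof -
      have "ln (1 / (1/2) ^ k) = real k * ln (2 :: real)"
        by (simp add: power_divide ln_realpow)
      moreover have "lim (\<lambda>N. ereal (c d' ((1/2) ^ k) N)) = ereal (S d' ((1/2) ^ k))"
        by (rule lim_eq) simp
      moreover have "k \<ge> k\<^sub>0" by (simp add: k_def)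
      ultimately show ?thesis using k0[of k] by simp
    qed
    then have "S d' ((1/2) ^ k) / (real k * ln 2) < real C" using ln2 by (simp add: k_def)
    then have "S d' ((1/2) ^ k) < real C * (real k * ln 2)"
      using ln2 by (simp add: k_def pos_divide_less_eq)
    also have "\<dots> \<le> real C * (real k * 1)" using ln2 by (intro mult_left_mono) auto
    also have "\<dots> \<le> real k * real k" by (simp add: k_def)
    finally show False using S'[of k] by (simp add: power2_eq_square)
  qed
  then obtain h where h: "\<And>\<epsilon>. \<epsilon> > 0 \<Longrightarrow> S d \<epsilon> \<le> h" by blast
  show thesis
  proof (rule that[of "max h 0 + 1"])
    fix \<epsilon> :: real assume \<epsilon>: "\<epsilon> > 0"
    have "\<forall>\<^sub>F N in sequentially. c d \<epsilon> N < max h 0 + 1"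
      by (rule order_tendstoD(2)[OF conv[OF D.compat \<epsilon>]]) (use h[OF \<epsilon>] in auto)
    then show "\<forall>\<^sub>F N in sequentially.
        ln (real (covering_number X (dyn_metric T d N) \<epsilon>)) \<le> (max h 0 + 1) * real N"
      using eventually_ge_at_top[of 1]
      by eventually_elim (simp add: c_def pos_divide_less_eq less_imp_le)
  qed auto
qed

section \<open>Maps to skeleta of cubes\<close>

text \<open>
  Unnormalized barycentric coordinate, at a point \<open>v\<close> of the cube over \<open>J\<close>, of the cube vertex that is
  the indicator of \<open>A\<close>, for the triangulation of the cube by chains of subsets of \<open>J\<close>. It is
  positive exactly when some level strictly inside the unit interval separates the coordinates in \<open>A\<close> from those off
  \<open>A\<close>; the product form avoids minima over possibly empty sets.
\<close>

definition vertex_weight :: "'j set \<Rightarrow> ('j \<Rightarrow> real) \<Rightarrow> 'j set \<Rightarrow> real" where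
  "vertex_weight J v A =
     (\<Prod>j\<in>A. \<Prod>i\<in>J - A. max 0 (v j - v i)) * (\<Prod>j\<in>A. v j) * (\<Prod>i\<in>J - A. 1 - v i)"

lemma vertex_weight_nonneg:
  assumes "\<And>j. j \<in> J \<Longrightarrow> 0 \<le> v j \<and> v j \<le> 1" "A \<subseteq> J"
  shows "0 \<le> vertex_weight J v A"
  unfolding vertex_weight_def
  by (intro mult_nonneg_nonneg prod_nonneg) (use assms in auto)

lemma vertex_weight_pos_iff:
  assumes "finite J" "\<And>j. j \<in> J \<Longrightarrow> 0 \<le> v j \<and> v j \<le> 1" "A \<subseteq> J"
  shows "0 < vertex_weight J v A \<longleftrightarrow>
    (\<forall>j\<in>A. \<forall>i\<in>J - A. v i < v j) \<and> (\<forall>j\<in>A. 0 < v j) \<and> (\<forall>i\<in>J - A. v i < 1)"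
proof -
  have fin: "finite A" "finite (J - A)" using assms finite_subset by auto
  have "0 < vertex_weight J v A \<longleftrightarrow> vertex_weight J v A \<noteq> 0"
    using vertex_weight_nonneg[of J v A] assms by auto
  also have "\<dots> \<longleftrightarrow> (\<forall>j\<in>A. \<forall>i\<in>J - A. max 0 (v j - v i) \<noteq> 0) \<and> (\<forall>j\<in>A. v j \<noteq> 0) \<and> (\<forall>i\<in>J - A. 1 - v i \<noteq> 0)"
    unfolding vertex_weight_def using fin by (simp add: prod_zero_iff)
  also have "\<dots> \<longleftrightarrow> (\<forall>j\<in>A. \<forall>i\<in>J - A. v i < v j) \<and> (\<forall>j\<in>A. 0 < v j) \<and> (\<forall>i\<in>J - A. v i < 1)"
  proof (intro conj_cong ball_cong refl)
    fix j i assume "j \<in> A" "i \<in> J - A"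
    show "max 0 (v j - v i) \<noteq> 0 \<longleftrightarrow> v i < v j" by (auto simp: max_def)
  next
    fix j assume "j \<in> A"
    then show "v j \<noteq> 0 \<longleftrightarrow> 0 < v j" using assms by force
  next
    fix i assume "i \<in> J - A"
    then show "1 - v i \<noteq> 0 \<longleftrightarrow> v i < 1" using assms by force
  qed
  finally show ?thesis .
qed

text \<open>
  A level \<open>t\<close> that is not a coordinate of \<open>v\<close> separates the coordinates, and \<open>A\<close> is the set of those
  above it.
\<close>

lemma vertex_weight_exists_pos:
  assumes "finite J" "\<And>j. j \<in> J \<Longrightarrow> 0 \<le> v j \<and> v j \<le> 1"
  obtains A where "A \<subseteq> J" "0 < vertex_weight J v A"
proof -
  have "infinite ({0<..<1 :: real} - v ` J)" using assms by (intro Diff_infinite_finite) auto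
  then obtain t where t: "0 < t" "t < 1" "t \<notin> v ` J"
    by (metis (no_types, lifting) Diff_iff ex_in_conv finite.emptyI greaterThanLessThan_iff)
  let ?A = "{j \<in> J. t < v j}"
  have below: "v i < t" if "i \<in> J - ?A" for i
  proof -
    have "v i \<noteq> t" using t(3) that by auto
    then show ?thesis using that by auto
  qed
  have "0 < vertex_weight J v ?A \<longleftrightarrow>
      (\<forall>j\<in>?A. \<forall>i\<in>J - ?A. v i < v j) \<and> (\<forall>j\<in>?A. 0 < v j) \<and> (\<forall>i\<in>J - ?A. v i < 1)"
    using assms by (intro vertex_weight_pos_iff) auto
  moreover have "\<forall>j\<in>?A. \<forall>i\<in>J - ?A. v i < v j" using below by fastforce
  moreover have "\<forall>j\<in>?A. 0 < v j" using t(1) by auto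
  moreover have "\<forall>i\<in>J - ?A. v i < 1" using below t(2) by fastforce
  ultimately have "0 < vertex_weight J v ?A" by blast
  then show ?thesis using that[of ?A] by blast
qed

text \<open>
  Of two incomparable sets, each would have to carry larger coordinates than the other.
\<close>

lemma vertex_support_chain:
  assumes "finite J" "\<And>j. j \<in> J \<Longrightarrow> 0 \<le> v j \<and> v j \<le> 1"
    and "A \<subseteq> J" "0 < vertex_weight J v A" "B \<subseteq> J" "0 < vertex_weight J v B"
  shows "A \<subseteq> B \<or> B \<subseteq> A"
proof (rule ccontr)
  assume "\<not> (A \<subseteq> B \<or> B \<subseteq> A)"
  then obtain i j where ij: "i \<in> A" "i \<notin> B" "j \<in> B" "j \<notin> A" by blast
  then have "v j < v i" using assms by (subst (asm) (1) vertex_weight_pos_iff) auto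
  moreover have "v i < v j" using ij assms(1-3,5,6) by (subst (asm) (1) vertex_weight_pos_iff) auto
  ultimately show False by simp
qed

text \<open>
  A set of positive weight contains all coordinates equal to \<open>1\<close> and no coordinate equal to \<open>0\<close>. So it is
  determined, within the chain, by the number of fractional coordinates that it contains.
\<close>

lemma vertex_support_card:
  assumes "finite J" "\<And>j. j \<in> J \<Longrightarrow> 0 \<le> v j \<and> v j \<le> 1"
    and "card {j \<in> J. 0 < v j \<and> v j < 1} \<le> k"
  shows "card {A. A \<subseteq> J \<and> 0 < vertex_weight J v A} \<le> Suc k"
proof -
  let ?C = "{A. A \<subseteq> J \<and> 0 < vertex_weight J v A}" and ?F = "{j \<in> J. 0 < v j \<and> v j < 1}"
  have split: "A = {j \<in> J. v j = 1} \<union> A \<inter> ?F" if "A \<in> ?C" for A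
  proof -
    have "A \<subseteq> J" "\<forall>j\<in>A. 0 < v j" "\<forall>i\<in>J - A. v i < 1"
      using that assms(1,2) by (auto simp: vertex_weight_pos_iff)
    then show ?thesis using assms(2) by force
  qed
  have "card ?C \<le> card {..k}"
  proof (rule card_inj_on_le[of "\<lambda>A. card (A \<inter> ?F)"])
    show "inj_on (\<lambda>A. card (A \<inter> ?F)) ?C"
    proof (rule inj_onI)
      fix A B assume A: "A \<in> ?C" and B: "B \<in> ?C" and eq: "card (A \<inter> ?F) = card (B \<inter> ?F)"
      have "A \<subseteq> B \<or> B \<subseteq> A" using A B vertex_support_chain[of J v A B] assms(1,2) by auto
      then have "A \<inter> ?F \<subseteq> B \<inter> ?F \<or> B \<inter> ?F \<subseteq> A \<inter> ?F" by blast
      moreover have "finite (A \<inter> ?F)" "finite (B \<inter> ?F)" using assms(1) by auto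
      ultimately have "A \<inter> ?F = B \<inter> ?F"
        using eq card_subset_eq[of "B \<inter> ?F" "A \<inter> ?F"] card_subset_eq[of "A \<inter> ?F" "B \<inter> ?F"] by argo
      then show "A = B" using split[OF A] split[OF B] by simp
    qed
    show "(\<lambda>A. card (A \<inter> ?F)) ` ?C \<subseteq> {..k}"
    proof (clarsimp)
      fix A
      have "card (A \<inter> ?F) \<le> card ?F" using assms(1) by (intro card_mono) auto
      then show "card (A \<inter> ?F) \<le> k" using assms(3) by linarith
    qed
  qed auto
  then show ?thesis by simp
qed

lemma local_dim_le:
  assumes K: "finite_complex K" and a: "a \<in> topspace (realization K)"
    and card: "\<And>s. s \<in> K \<Longrightarrow> card s \<le> Suc k"
  shows "local_dim K a \<le> k"
proof -
  have "{s \<in> K. a \<in> closed_simplex s} \<noteq> {}" using a by (auto simp: realization_def)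
  moreover have "finite {s \<in> K. a \<in> closed_simplex s}" using K by (auto simp: finite_complex_def)
  ultimately show ?thesis unfolding local_dim_def by (subst Max_le_iff) (use card in force)+
qed

text \<open>
  The complex consists of all sets of at most \<open>Suc k\<close> vertices of the cube, and normalized vertex weights
  are the barycentric coordinates. A point at which a coordinate is \<open>1\<close> is not
  identified with a point at which it is \<open>0\<close>, because a vertex of positive weight common to both has to
  contain that coordinate; this separation is what makes the map an \<open>\<epsilon>\<close>-embedding below.
\<close>

lemma map_to_skeleton:
  fixes X :: "'a topology" and y :: "'a \<Rightarrow> 'j \<Rightarrow> real"
  assumes J: "finite J"
    and cont: "\<And>j. j \<in> J \<Longrightarrow> continuous_map X euclideanreal (\<lambda>x. y x j)"
    and range: "\<And>x j. x \<in> topspace X \<Longrightarrow> j \<in> J \<Longrightarrow> 0 \<le> y x j \<and> y x j \<le> 1"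
    and few: "\<And>x. x \<in> topspace X \<Longrightarrow> card {j \<in> J. 0 < y x j \<and> y x j < 1} \<le> k"
  obtains K f where "finite_complex K" "continuous_map X (realization K) f"
    "\<And>x. x \<in> topspace X \<Longrightarrow> local_dim K (f x) \<le> k"
    "\<And>x x' j. x \<in> topspace X \<Longrightarrow> x' \<in> topspace X \<Longrightarrow> f x = f x' \<Longrightarrow> j \<in> J \<Longrightarrow>
       y x j = 1 \<Longrightarrow> 0 < y x' j"
proof -
  obtain enc :: "'j set \<Rightarrow> nat" where enc: "inj_on enc (Pow J)"
    using finite_imp_inj_to_nat_seg[of "Pow J"] J by auto
  define dec where "dec = inv_into (Pow J) enc"
  have dec: "dec (enc A) = A" if "A \<subseteq> J" for A
    unfolding dec_def using enc that by (intro inv_into_f_f) auto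
  define w where "w x A = vertex_weight J (y x) A" for x A
  define tot where "tot x = (\<Sum>A\<in>Pow J. w x A)" for x
  define f where "f x i = (if i \<in> enc ` Pow J then w x (dec i) / tot x else 0)" for x i
  define K where "K = {enc ` C | C. C \<subseteq> Pow J \<and> C \<noteq> {} \<and> card C \<le> Suc k}"
  define supp where "supp x = {A. A \<subseteq> J \<and> 0 < w x A}" for x
  have wnn: "0 \<le> w x A" if "x \<in> topspace X" "A \<subseteq> J" for x A
    unfolding w_def using range that by (intro vertex_weight_nonneg) auto
  have wpos: "0 < w x A \<longleftrightarrow>
      (\<forall>j\<in>A. \<forall>i\<in>J - A. y x i < y x j) \<and> (\<forall>j\<in>A. 0 < y x j) \<and> (\<forall>i\<in>J - A. y x i < 1)"
    if "x \<in> topspace X" "A \<subseteq> J" for x A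
    unfolding w_def using J range that by (intro vertex_weight_pos_iff) auto
  have ex: "\<exists>A\<subseteq>J. 0 < w x A" if "x \<in> topspace X" for x
    unfolding w_def using vertex_weight_exists_pos[OF J, of "y x"] range that by metis
  have tot: "0 < tot x" if x: "x \<in> topspace X" for x
  proof -
    obtain A where "A \<subseteq> J" "0 < w x A" using ex[OF x] by blast
    then show ?thesis unfolding tot_def using J wnn[OF x] by (intro sum_pos2[of _ A]) auto
  qed
  have fenc: "f x (enc A) = w x A / tot x" if "A \<subseteq> J" for x A
    using that dec by (auto simp: f_def)
  have complex: "finite_complex K"
    unfolding finite_complex_def
  proof (intro conjI ballI allI impI)
    have "K \<subseteq> (`) enc ` Pow (Pow J)" by (auto simp: K_def)
    then show "finite K" using J by (meson finite_Pow_iff finite_imageI finite_subset)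
    fix s assume "s \<in> K"
    then obtain C where C: "s = enc ` C" "C \<subseteq> Pow J" "C \<noteq> {}" "card C \<le> Suc k" by (auto simp: K_def)
    have finC: "finite C" using C J by (meson finite_Pow_iff finite_subset)
    then show "finite s" "s \<noteq> {}" using C by auto
    fix t assume t: "t \<noteq> {} \<and> t \<subseteq> s"
    then obtain C' where C': "C' \<subseteq> C" "t = enc ` C'" using C subset_imageE by metis
    then have "card C' \<le> card C" using finC by (intro card_mono)
    then have "C' \<subseteq> Pow J \<and> C' \<noteq> {} \<and> card C' \<le> Suc k"
      using C C' t by auto
    then show "t \<in> K" unfolding K_def C'(2) by (intro CollectI exI[of _ C'] conjI refl) auto
  qed
  have supp: "enc ` supp x \<in> K" if x: "x \<in> topspace X" for x
  proof -
    have "card (supp x) \<le> Suc k"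
      unfolding supp_def w_def using J range few x by (intro vertex_support_card) auto
    moreover have "supp x \<noteq> {}" "supp x \<subseteq> Pow J" using ex[OF x] by (auto simp: supp_def)
    ultimately show ?thesis
      unfolding K_def by (intro CollectI exI[of _ "supp x"] conjI refl)
  qed
  have simplex: "f x \<in> closed_simplex (enc ` supp x)" if x: "x \<in> topspace X" for x
    unfolding closed_simplex_def
  proof (intro CollectI conjI allI impI)
    fix i
    show "0 \<le> f x i" using wnn[OF x] tot[OF x] dec by (auto simp: f_def)
    assume i: "i \<notin> enc ` supp x"
    show "f x i = 0"
    proof (cases "i \<in> enc ` Pow J")
      case True
      then obtain A where A: "A \<subseteq> J" "i = enc A" by auto
      then have "w x A = 0" using i wnn[OF x A(1)] by (force simp: supp_def)
      then show ?thesis using A fenc by simp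
    qed (simp add: f_def)
  next
    have sub: "supp x \<subseteq> Pow J" by (auto simp: supp_def)
    have "(\<Sum>i\<in>enc ` supp x. f x i) = (\<Sum>A\<in>supp x. f x (enc A))"
      using enc sub by (simp add: sum.reindex inj_on_subset)
    also have "\<dots> = (\<Sum>A\<in>supp x. w x A / tot x)"
      using sub by (intro sum.cong) (auto simp: fenc)
    also have "\<dots> = (\<Sum>A\<in>Pow J. w x A / tot x)"
    proof (rule sum.mono_neutral_left)
      show "\<forall>A\<in>Pow J - supp x. w x A / tot x = 0"
      proof
        fix A assume "A \<in> Pow J - supp x"
        then have "A \<subseteq> J" "\<not> 0 < w x A" by (auto simp: supp_def)
        with wnn[OF x, of A] show "w x A / tot x = 0" by simp
      qed
    qed (use J sub in auto)
    also have "\<dots> = 1" using tot[OF x] by (simp add: tot_def flip: sum_divide_distrib)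
    finally show "(\<Sum>i\<in>enc ` supp x. f x i) = 1" .
  qed
  have wcont: "continuous_map X euclideanreal (\<lambda>x. w x A)" if "A \<subseteq> J" for A
    unfolding w_def vertex_weight_def
    using J that finite_subset[OF that J]
    by (intro continuous_intros cont) auto
  have "continuous_map X (powertop_real UNIV) f"
    unfolding continuous_map_componentwise_UNIV
  proof
    fix i
    show "continuous_map X euclideanreal (\<lambda>x. f x i)"
    proof (cases "i \<in> enc ` Pow J")
      case True
      then have "dec i \<subseteq> J" using dec by auto
      moreover have "continuous_map X euclideanreal tot"
        unfolding tot_def using J by (intro continuous_map_sum wcont) auto
      ultimately have "continuous_map X euclideanreal (\<lambda>x. w x (dec i) / tot x)"
        using tot by (intro continuous_map_real_divide wcont) force+
      then show ?thesis using True by (simp add: f_def)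
    qed (simp add: f_def)
  qed
  then have contf: "continuous_map X (realization K) f"
    unfolding realization_def continuous_map_in_subtopology using simplex supp by auto
  show thesis
  proof (rule that[OF complex contf])
    fix x assume x: "x \<in> topspace X"
    show "local_dim K (f x) \<le> k"
    proof (rule local_dim_le[OF complex])
      show "f x \<in> topspace (realization K)" using contf x by (auto simp: continuous_map_def)
      fix s assume "s \<in> K"
      then obtain C where C: "s = enc ` C" "C \<subseteq> Pow J" "card C \<le> Suc k" by (auto simp: K_def)
      then show "card s \<le> Suc k" using enc by (simp add: card_image inj_on_subset)
    qed
  next
    fix x x' j
    assume x: "x \<in> topspace X" "x' \<in> topspace X" and eq: "f x = f x'" and j: "j \<in> J" "y x j = 1"
    obtain A where A: "A \<subseteq> J" "0 < w x A" using ex[OF x(1)] by blast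
    then have "\<forall>i\<in>J - A. y x i < 1" using x by (simp add: wpos)
    then have "j \<in> A" using j by force
    moreover have "0 < w x' A"
    proof -
      have "w x A / tot x = w x' A / tot x'" using fenc[OF A(1)] eq by metis
      then have "0 < w x' A / tot x'" using A tot[OF x(1)] by (metis divide_pos_pos)
      then show ?thesis using tot[OF x(2)] by (simp add: zero_less_divide_iff)
    qed
    ultimately show "0 < y x' j" using A x by (auto simp: wpos)
  qed
qed

section \<open>Choosing thresholds\<close>

text \<open>
  First-moment argument. Give a choice \<open>\<xi>\<close> the weight \<open>m\<close> to the power of its number of bad coordinates.
  Over all \<open>m ^ card J\<close> choices the weights for a fixed \<open>U\<close> sum up to a product of factors of at most
  \<open>m + 2 m\<close>, so few choices have more than \<open>k\<close> bad coordinates; summing over \<open>U\<close>, some choice is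
  left.
\<close>

lemma thresholds_exist:
  fixes bad :: "'u \<Rightarrow> 'j \<Rightarrow> nat set"
  assumes J: "finite J" and \<U>: "finite \<U>" and m: "m \<ge> 1"
    and bad: "\<And>U j. U \<in> \<U> \<Longrightarrow> j \<in> J \<Longrightarrow> card (bad U j \<inter> {..<m}) \<le> 2"
    and small: "card \<U> * 3 ^ card J < m ^ Suc k"
  obtains \<xi> where "\<And>j. j \<in> J \<Longrightarrow> \<xi> j < m" "\<And>U. U \<in> \<U> \<Longrightarrow> card {j \<in> J. \<xi> j \<in> bad U j} \<le> k"
proof -
  define \<Xi> where "\<Xi> = PiE J (\<lambda>_. {..<m})"
  define B where "B U = {\<xi> \<in> \<Xi>. k < card {j \<in> J. \<xi> j \<in> bad U j}}" for U
  have fin: "finite \<Xi>" unfolding \<Xi>_def using J by (intro finite_PiE) auto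
  have card\<Xi>: "card \<Xi> = m ^ card J" unfolding \<Xi>_def using J by (simp add: card_PiE)
  have B: "card (B U) * m ^ Suc k \<le> (3 * m) ^ card J" if U: "U \<in> \<U>" for U
  proof -
    let ?w = "\<lambda>j a. if a \<in> bad U j then m else 1"
    have "card (B U) * m ^ Suc k = (\<Sum>\<xi>\<in>B U. m ^ Suc k)" by simp
    also have "\<dots> \<le> (\<Sum>\<xi>\<in>B U. \<Prod>j\<in>J. ?w j (\<xi> j))"
    proof (rule sum_mono)
      fix \<xi> assume \<xi>: "\<xi> \<in> B U"
      have "m ^ Suc k \<le> m ^ card {j \<in> J. \<xi> j \<in> bad U j}"
        using \<xi> m by (intro power_increasing) (auto simp: B_def)
      also have "\<dots> = (\<Prod>j\<in>J. ?w j (\<xi> j))"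
        using J by (subst prod.If_cases) (auto simp: Int_def)
      finally show "m ^ Suc k \<le> (\<Prod>j\<in>J. ?w j (\<xi> j))" .
    qed
    also have "\<dots> \<le> (\<Sum>\<xi>\<in>\<Xi>. \<Prod>j\<in>J. ?w j (\<xi> j))"
      using fin by (intro sum_mono2) (auto simp: B_def)
    also have "\<dots> = (\<Prod>j\<in>J. \<Sum>a<m. ?w j a)"
      unfolding \<Xi>_def using J by (subst prod_sum_PiE) auto
    also have "\<dots> \<le> (\<Prod>j\<in>J. 3 * m)"
    proof (rule prod_mono)
      fix j assume j: "j \<in> J"
      have "(\<Sum>a<m. ?w j a) \<le> (\<Sum>a<m. 1 + (if a \<in> bad U j then m else 0))"
        by (intro sum_mono) auto
      also have "\<dots> = m + card ({..<m} \<inter> bad U j) * m"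
        by (subst sum.distrib) (simp add: sum.If_cases Int_def)
      also have "\<dots> \<le> m + 2 * m" using bad[OF U j] by (intro add_mono mult_right_mono) (auto simp: Int_commute)
      finally show "0 \<le> (\<Sum>a<m. ?w j a) \<and> (\<Sum>a<m. ?w j a) \<le> 3 * m" by simp
    qed
    finally show ?thesis by simp
  qed
  have "\<not> \<Xi> \<subseteq> (\<Union>U\<in>\<U>. B U)"
  proof
    assume "\<Xi> \<subseteq> (\<Union>U\<in>\<U>. B U)"
    then have "card \<Xi> \<le> card (\<Union>U\<in>\<U>. B U)"
      using \<U> fin by (intro card_mono) (auto simp: B_def)
    also have "\<dots> \<le> (\<Sum>U\<in>\<U>. card (B U))" by (rule card_UN_le[OF \<U>])
    finally have "m ^ card J * m ^ Suc k \<le> (\<Sum>U\<in>\<U>. card (B U)) * m ^ Suc k"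
      unfolding card\<Xi> by (rule mult_right_mono) simp
    also have "\<dots> = (\<Sum>U\<in>\<U>. card (B U) * m ^ Suc k)" by (simp only: sum_distrib_right)
    also have "\<dots> \<le> (\<Sum>U\<in>\<U>. (3 * m) ^ card J)" by (intro sum_mono B)
    also have "\<dots> = (card \<U> * 3 ^ card J) * m ^ card J" by (simp add: power_mult_distrib)
    also have "\<dots> < m ^ Suc k * m ^ card J" using small m by (intro mult_strict_right_mono) auto
    finally show False by (simp add: mult.commute)
  qed
  then obtain \<xi> where \<xi>: "\<xi> \<in> \<Xi>" "\<And>U. U \<in> \<U> \<Longrightarrow> \<xi> \<notin> B U" by blast
  show thesis
  proof (rule that[of \<xi>])
    show "\<xi> j < m" if "j \<in> J" for j using \<xi>(1) that by (auto simp: \<Xi>_def PiE_def Pi_def)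
    show "card {j \<in> J. \<xi> j \<in> bad U j} \<le> k" if "U \<in> \<U>" for U
      using \<xi>(2)[OF that] \<xi>(1) by (auto simp: B_def not_less)
  qed
qed

context compact_system
begin

lemma continuous_dist: "continuous_map X euclideanreal (\<lambda>x. d x s)" if "s \<in> topspace X"
proof -
  let ?m = "metric (topspace X, d)"
  have X: "mtopology_of ?m = X" using mtop by (simp add: M.mtopology_of)
  have "continuous_map X euclideanreal (\<lambda>x. mdist ?m x s)"
    by (rule continuous_map_mdist)
      (use that continuous_map_id[of X] in \<open>simp_all add: X mtop id_def\<close>)
  then show ?thesis by simp
qed

lemma finite_net:
  assumes "\<eta> > 0"
  obtains F where "finite F" "F \<subseteq> topspace X" "\<And>x. x \<in> topspace X \<Longrightarrow> \<exists>s\<in>F. d x s < \<eta>"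
proof -
  let ?\<C> = "(\<lambda>s. M.mball s \<eta>) ` topspace X"
  have "topspace X \<subseteq> \<Union>?\<C>" using assms by auto
  then have "\<exists>\<F>. finite \<F> \<and> \<F> \<subseteq> ?\<C> \<and> topspace X \<subseteq> \<Union>\<F>"
    using compact[unfolded compact_space_alt, rule_format, of ?\<C>] open_ball by auto
  then obtain F where F: "finite F" "F \<subseteq> topspace X" "topspace X \<subseteq> \<Union>((\<lambda>s. M.mball s \<eta>) ` F)"
    using finite_subset_image[of _ "\<lambda>s. M.mball s \<eta>" "topspace X"] by metis
  show thesis
  proof (rule that[OF F(1,2)])
    fix x assume "x \<in> topspace X"
    then obtain s where "s \<in> F" "x \<in> M.mball s \<eta>" using F(3) by blast
    then show "\<exists>s\<in>F. d x s < \<eta>" using M.commute by auto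
  qed
qed

text \<open>
  The number \<open>m\<close> of admissible radii depends on \<open>\<delta>\<close>, on the entropy bound \<open>h\<close> and on the size of the net, but
  not on \<open>N\<close>. It fixes the width \<open>w\<close> of the annuli, and only then is the entropy bound applied, at
  scale \<open>w\<close>; this order works because \<open>h\<close> is the same for all scales.
\<close>

lemma low_dimensional_embedding:
  assumes \<epsilon>: "\<epsilon> > 0" and \<delta>: "\<delta> > 0"
    and h: "\<And>\<epsilon>. \<epsilon> > 0 \<Longrightarrow>
      \<forall>\<^sub>F N in sequentially. ln (real (covering_number X (dyn_metric T d N) \<epsilon>)) \<le> h * real N"
  shows "\<forall>\<^sub>F N in sequentially. \<exists>K f. finite_complex K \<and>
     eps_embedding X (dyn_metric T d N) \<epsilon> (realization K) f \<and>
     (\<forall>x\<in>topspace X. real (local_dim K (f x)) \<le> \<delta> * real N)"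
proof -
  define \<eta> where "\<eta> = \<epsilon> / 8"
  have \<eta>: "\<eta> > 0" using \<epsilon> by (simp add: \<eta>_def)
  obtain F where F: "finite F" "F \<subseteq> topspace X" "\<And>x. x \<in> topspace X \<Longrightarrow> \<exists>s\<in>F. d x s < \<eta>"
    using finite_net[OF \<eta>] by blast
  define D where "D = card F"
  \<comment> \<open>large enough that \<open>exp (h N) * 3 ^ (N D) < m powr (\<delta> N)\<close>\<close>
  define m where "m = nat \<lceil>exp (max 0 ((h + real D * ln 3 + 1) / \<delta>))\<rceil>"
  have m_exp: "exp (max 0 ((h + real D * ln 3 + 1) / \<delta>)) \<le> real m"
    unfolding m_def by (meson of_nat_ceiling)
  have "1 \<le> exp (max 0 ((h + real D * ln 3 + 1) / \<delta>))" by simp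
  then have m1: "m \<ge> 1" using m_exp by linarith
  have "(h + real D * ln 3 + 1) / \<delta> \<le> ln (real m)"
    using m_exp m1 by (subst ln_ge_iff) (auto intro: order_trans[rotated])
  then have m_ln: "h + real D * ln 3 + 1 \<le> \<delta> * ln (real m)" using \<delta> by (simp add: field_simps)
  define w where "w = \<eta> / real m"
  have w: "w > 0" using \<eta> m1 by (simp add: w_def)
  have mw: "real m * w = \<eta>" using m1 by (simp add: w_def)
  define r where "r a = \<eta> + real a * w" for a :: nat
  have r_le: "r a + w \<le> 2 * \<eta>" if "a < m" for a
  proof -
    have "(real a + 1) * w \<le> real m * w" using that w by (intro mult_right_mono) auto
    then show ?thesis using mw by (simp add: r_def algebra_simps)
  qed
  \<comment> \<open>\<open>g a\<close> falls from \<open>1\<close> to \<open>0\<close> on the annulus of inner radius \<open>r a\<close>; all annuli lie between the radii \<open>\<eta>\<close> and \<open>2 \<eta>\<close>\<close>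
  define g where "g a t = min 1 (max 0 ((r a + w - t) / w))" for a and t :: real
  have g_frac: "r a < t \<and> t < r a + w" if "0 < g a t" "g a t < 1" for a t
    using that w by (auto simp: g_def min_def max_def field_simps split: if_splits)
  have g_one: "g a t = 1" if "t < \<eta>" for a t
  proof -
    have "0 \<le> real a * w" using w by simp
    then have "w \<le> r a + w - t" using that by (simp add: r_def)
    then have "1 \<le> (r a + w - t) / w" using w by (simp add: le_divide_eq)
    then show ?thesis by (simp add: g_def)
  qed
  have g_pos: "t < 2 * \<eta>" if "0 < g a t" "a < m" for a t
  proof (rule ccontr)
    assume "\<not> t < 2 * \<eta>"
    then have "(r a + w - t) / w \<le> 0"
      using r_le[OF that(2)] w by (intro divide_nonpos_pos) auto
    then show False using that(1) by (simp add: g_def)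
  qed
  show ?thesis
    using h[OF w] eventually_ge_at_top[of 1]
  proof eventually_elim
    case (elim N)
    note N = elim(2)
    define J where "J = {..<N} \<times> F"
    have J: "finite J" "card J = N * D" using F(1) by (auto simp: J_def D_def)
    define k where "k = nat \<lfloor>\<delta> * real N\<rfloor>"
    have k: "real k \<le> \<delta> * real N" "\<delta> * real N < real (Suc k)"
      using \<delta> by (auto simp: k_def) linarith
    obtain \<U> where \<U>: "metric_cover X (dyn_metric T d N) w \<U>"
      "card \<U> = covering_number X (dyn_metric T d N) w"
      using covering_number_attained metric_cover_exists[OF N w] by metis
    have fin\<U>: "finite \<U>" using \<U> by (simp add: metric_cover_def)
    have small: "card \<U> * 3 ^ card J < m ^ Suc k"
    proof (cases "card \<U> = 0")
      case False
      have "ln (real (card \<U>)) + real (N * D) * ln 3 < real (Suc k) * ln (real m)"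
      proof -
        have "ln (real (card \<U>)) + real (N * D) * ln 3 \<le> h * real N + real N * (real D * ln 3)"
          using elim(1) \<U>(2) by simp
        also have "\<dots> = (h + real D * ln 3) * real N" by (simp add: algebra_simps)
        also have "\<dots> < (\<delta> * ln (real m)) * real N"
          using m_ln N by (intro mult_strict_right_mono) auto
        also have "\<dots> = (\<delta> * real N) * ln (real m)" by simp
        also have "\<dots> \<le> real (Suc k) * ln (real m)"
          using k m1 by (intro mult_right_mono) auto
        finally show ?thesis .
      qed
      also have "ln (real (card \<U>)) + real (N * D) * ln 3 = ln (real (card \<U> * 3 ^ card J))"
        using False by (simp add: ln_mult ln_realpow J)
      also have "real (Suc k) * ln (real m) = ln (real (m ^ Suc k))"
        using m1 by (simp add: ln_realpow del: power_Suc of_nat_Suc)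
      finally show ?thesis using False m1
        by (subst (asm) ln_less_cancel_iff) (auto simp del: power_Suc simp flip: of_nat_mult of_nat_power simp: of_nat_less_iff)
    qed (use m1 in auto)
    define bad where "bad U = (\<lambda>(n, s). {a. \<exists>x\<in>U \<inter> topspace X. r a < d ((T ^^ n) x) s \<and> d ((T ^^ n) x) s < r a + w})" for U
    \<comment> \<open>a set of diameter below \<open>w\<close> cannot meet two annuli that have a third one between them\<close>
    have bad_close: "b \<le> Suc a"
      if U: "U \<in> \<U>" and ns: "n < N" "s \<in> F" and a: "a \<in> bad U (n, s)" and b: "b \<in> bad U (n, s)"
      for U n s a b
    proof (rule ccontr)
      assume "\<not> b \<le> Suc a"
      then have "real a + 2 \<le> real b" by linarith
      then have "(real a + 2) * w \<le> real b * w" using w by (intro mult_right_mono) auto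
      then have rab: "r a + 2 * w \<le> r b" by (simp add: r_def algebra_simps)
      obtain x where x: "x \<in> U" "x \<in> topspace X" "d ((T ^^ n) x) s < r a + w"
        using a by (auto simp: bad_def)
      obtain x' where x': "x' \<in> U" "x' \<in> topspace X" "r b < d ((T ^^ n) x') s"
        using b by (auto simp: bad_def)
      obtain q where q: "q < w" "\<forall>x\<in>U. \<forall>y\<in>U. dyn_metric T d N x y \<le> q"
        using \<U>(1) U by (auto simp: metric_cover_def diam_less_iff[OF w])
      have "d ((T ^^ n) x') ((T ^^ n) x) \<le> dyn_metric T d N x' x" by (rule dyn_metric_ge[OF ns(1)])
      then have "d ((T ^^ n) x') ((T ^^ n) x) < w" using q x x' by force
      moreover have "d ((T ^^ n) x') s \<le> d ((T ^^ n) x') ((T ^^ n) x) + d ((T ^^ n) x) s"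
        using x x' ns F iter_in by (intro M.triangle) auto
      ultimately show False using x x' rab by linarith
    qed
    have bad: "card (bad U j \<inter> {..<m}) \<le> 2" if U: "U \<in> \<U>" and j: "j \<in> J" for U j
    proof (cases "bad U j \<inter> {..<m} = {}")
      case False
      define a where "a = Min (bad U j \<inter> {..<m})"
      have a: "a \<in> bad U j \<inter> {..<m}" unfolding a_def using False by (intro Min_in) auto
      have "bad U j \<inter> {..<m} \<subseteq> {a, Suc a}"
      proof
        fix b assume b: "b \<in> bad U j \<inter> {..<m}"
        then have "a \<le> b" unfolding a_def by (intro Min_le) auto
        moreover have "b \<le> Suc a"
          using bad_close[OF U, of "fst j" "snd j" a b] a b j by (auto simp: J_def)
        ultimately show "b \<in> {a, Suc a}" by auto
      qed
      then have "card (bad U j \<inter> {..<m}) \<le> card {a, Suc a}" by (intro card_mono) auto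
      then show ?thesis by simp
    qed simp
    obtain \<xi> where \<xi>: "\<And>j. j \<in> J \<Longrightarrow> \<xi> j < m" "\<And>U. U \<in> \<U> \<Longrightarrow> card {j \<in> J. \<xi> j \<in> bad U j} \<le> k"
      using thresholds_exist[of J \<U> m bad k, OF J(1) fin\<U> m1 bad small] by blast
    define y where "y x = (\<lambda>(n, s). g (\<xi> (n, s)) (d ((T ^^ n) x) s))" for x
    obtain K f where Kf: "finite_complex K" "continuous_map X (realization K) f"
      "\<And>x. x \<in> topspace X \<Longrightarrow> local_dim K (f x) \<le> k"
      "\<And>x x' j. x \<in> topspace X \<Longrightarrow> x' \<in> topspace X \<Longrightarrow> f x = f x' \<Longrightarrow> j \<in> J \<Longrightarrow>
         y x j = 1 \<Longrightarrow> 0 < y x' j"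
    proof (rule map_to_skeleton[of J X y k, OF J(1)])
      fix j assume "j \<in> J"
      then obtain n s where j: "j = (n, s)" "s \<in> F" by (auto simp: J_def)
      have "continuous_map X euclideanreal ((\<lambda>x. d x s) \<circ> (T ^^ n))"
        using j F by (intro continuous_map_compose[OF cont_iter] continuous_dist) auto
      then have "continuous_map X euclideanreal (\<lambda>x. d ((T ^^ n) x) s)" by (simp add: comp_def)
      then show "continuous_map X euclideanreal (\<lambda>x. y x j)"
        unfolding y_def j g_def using w by (auto intro!: continuous_intros)
    next
      show "0 \<le> y x j \<and> y x j \<le> 1" for x j by (auto simp: y_def g_def split: prod.split)
    next
      fix x assume x: "x \<in> topspace X"
      then obtain U where U: "U \<in> \<U>" "x \<in> U" using \<U>(1) by (auto simp: metric_cover_def)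
      have "{j \<in> J. 0 < y x j \<and> y x j < 1} \<subseteq> {j \<in> J. \<xi> j \<in> bad U j}"
        using U x g_frac by (fastforce simp: y_def bad_def)
      then have "card {j \<in> J. 0 < y x j \<and> y x j < 1} \<le> card {j \<in> J. \<xi> j \<in> bad U j}"
        using J by (intro card_mono) auto
      then show "card {j \<in> J. 0 < y x j \<and> y x j < 1} \<le> k" using \<xi>(2)[OF U(1)] by linarith
    qed blast
    have close: "dyn_metric T d N x x' \<le> 3 * \<eta>"
      if x: "x \<in> topspace X" "x' \<in> topspace X" and eq: "f x = f x'" for x x'
      unfolding dyn_metric_le_iff[OF N]
    proof (intro allI impI)
      fix n assume n: "n < N"
      obtain s where s: "s \<in> F" "d ((T ^^ n) x) s < \<eta>" using F(3) iter_in x by blast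
      have j: "(n, s) \<in> J" using n s by (simp add: J_def)
      have "y x (n, s) = 1" using s g_one by (simp add: y_def)
      then have "0 < y x' (n, s)" using Kf(4)[OF x eq j] by blast
      then have "d ((T ^^ n) x') s < 2 * \<eta>" using g_pos \<xi>(1)[OF j] by (simp add: y_def)
      moreover have "d ((T ^^ n) x) ((T ^^ n) x') \<le> d ((T ^^ n) x) s + d s ((T ^^ n) x')"
        using x s F iter_in by (intro M.triangle) auto
      ultimately show "d ((T ^^ n) x) ((T ^^ n) x') \<le> 3 * \<eta>" using s M.commute[of s] by simp
    qed
    have "diam (dyn_metric T d N) {x \<in> topspace X. f x = p} < ereal \<epsilon>" for p
      unfolding diam_less_iff[OF \<epsilon>]
      by (intro exI[of _ "3 * \<eta>"]) (use close \<epsilon> in \<open>auto simp: \<eta>_def\<close>)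
    then have "eps_embedding X (dyn_metric T d N) \<epsilon> (realization K) f"
      using Kf(2) by (simp add: eps_embedding_def)
    moreover have "real (local_dim K (f x)) \<le> \<delta> * real N" if "x \<in> topspace X" for x
      using Kf(3)[OF that] k(1) by linarith
    ultimately show ?case using Kf(1) by blast
  qed
qed

end

section \<open>Rate distortion dimension\<close>

text \<open>
  By the chain rule the left-hand side is the entropy of \<open>B\<close> minus the conditional entropy of \<open>B\<close> given
  \<open>A\<close>.
\<close>

lemma information_le_ln_card:
  assumes P: "prob_space P" and A: "simple_function P A" and B: "simple_function P B"
  shows "shannon_entropy P A + shannon_entropy P B - shannon_entropy P (\<lambda>\<omega>. (A \<omega>, B \<omega>))
      \<le> ln (real (card (B ` space P)))"
proof -
  interpret prob_space P by fact
  interpret information_space P "exp 1" by unfold_locales simp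
  let ?HBA = "conditional_entropy (exp 1) (count_space (B ` space P)) (count_space (A ` space P)) B A"
  have "shannon_entropy P (\<lambda>\<omega>. (A \<omega>, B \<omega>)) = shannon_entropy P A + ?HBA"
    unfolding shannon_entropy_def by (rule entropy_chain_rule[OF A B])
  moreover have "0 \<le> ?HBA" by (rule conditional_entropy_nonneg[OF B A])
  moreover have "shannon_entropy P B \<le> log (exp 1) (card (B ` space P))"
    unfolding shannon_entropy_def by (rule entropy_le_card[OF simple_distributedI[OF B measure_nonneg refl]])
  ultimately show ?thesis by (simp add: log_def)
qed

lemma shannon_entropy_const:
  assumes "prob_space P"
  shows "shannon_entropy P (\<lambda>_. c) = 0"
proof -
  interpret prob_space P by fact
  have "(\<lambda>_. c) ` space P = {c}" using not_empty by auto
  moreover have "(\<lambda>_. c) -` {c} \<inter> space P = space P" by auto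
  ultimately show ?thesis
    by (subst shannon_entropy_eq[OF assms]) (simp_all add: prob_space)
qed

lemma mutual_info_nonneg:
  assumes "prob_space P"
  shows "0 \<le> mutual_info P S R Z Y"
  unfolding mutual_info_def
  by (rule SUP_upper2[of "(\<lambda>_. 0, \<lambda>_. 0)"])
    (auto simp: comp_def shannon_entropy_const[OF assms] simp flip: zero_ereal_def)

text \<open>
  A variable that factors through a finite set \<open>I\<close> takes, after any quantization, at most \<open>card I\<close>
  values.
\<close>

lemma mutual_info_le_ln_card:
  assumes P: "prob_space P" and Z: "Z \<in> measurable P S" and Y: "Y \<in> measurable P R"
    and I: "finite I" "\<And>\<omega>. \<omega> \<in> space P \<Longrightarrow> \<iota> \<omega> \<in> I" "\<And>\<omega>. \<omega> \<in> space P \<Longrightarrow> Y \<omega> = y (\<iota> \<omega>)"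
  shows "mutual_info P S R Z Y \<le> ereal (ln (real (card I)))"
  unfolding mutual_info_def
proof (rule SUP_least, clarsimp)
  fix f :: "_ \<Rightarrow> nat" and g :: "_ \<Rightarrow> nat" assume f: "simple_function S f" and g: "simple_function R g"
  interpret prob_space P by fact
  have fZ: "simple_function P (f \<circ> Z)" unfolding comp_def by (rule simple_function_comp[OF Z f])
  have gY: "simple_function P (g \<circ> Y)" unfolding comp_def by (rule simple_function_comp[OF Y g])
  have sub: "(g \<circ> Y) ` space P \<subseteq> (g \<circ> y) ` I" using I by auto
  have "card ((g \<circ> Y) ` space P) \<le> card ((g \<circ> y) ` I)" using I(1) sub by (intro card_mono) auto
  also have "\<dots> \<le> card I" using I(1) by (rule card_image_le)
  finally have card: "card ((g \<circ> Y) ` space P) \<le> card I" .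
  have "finite ((g \<circ> Y) ` space P)" using finite_subset[OF sub] I(1) by simp
  then have pos: "0 < card ((g \<circ> Y) ` space P)" using not_empty by (simp add: card_gt_0_iff)
  have "shannon_entropy P (f \<circ> Z) + shannon_entropy P (g \<circ> Y)
      - shannon_entropy P (\<lambda>\<omega>. ((f \<circ> Z) \<omega>, (g \<circ> Y) \<omega>)) \<le> ln (real (card ((g \<circ> Y) ` space P)))"
    by (rule information_le_ln_card[OF P fZ gY])
  also have "\<dots> \<le> ln (real (card I))" using card pos by simp
  finally show "shannon_entropy P (f \<circ> Z) + shannon_entropy P (g \<circ> Y)
      - shannon_entropy P (\<lambda>\<omega>. (f (Z \<omega>), g (Y \<omega>))) \<le> ln (real (card I))"
    by (simp add: comp_def)
qed

lemma rate_distortion_nonneg: "0 \<le> rate_distortion X T d \<mu> \<epsilon>"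
  unfolding rate_distortion_def
  by (rule INF_greatest) (auto intro!: zero_le_divide_ereal mutual_info_nonneg)

lemma borel_algebra_space [simp]: "space (borel_algebra X) = topspace X"
  unfolding borel_algebra_def by (rule space_measure_of) (auto dest: openin_subset)

lemma sets_borel_algebra: "sets (borel_algebra X) = sigma_sets (topspace X) {U. openin X U}"
  unfolding borel_algebra_def by (rule sets_measure_of) (auto dest: openin_subset)

lemma openin_borel: "openin X U \<Longrightarrow> U \<in> sets (borel_algebra X)"
  by (auto simp: sets_borel_algebra)

lemma continuous_map_borel_measurable:
  assumes "continuous_map X X T"
  shows "T \<in> measurable (borel_algebra X) (borel_algebra X)"
proof (rule measurable_sigma_sets[OF sets_borel_algebra])
  show "{U. openin X U} \<subseteq> Pow (topspace X)" by (auto dest: openin_subset)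
  show "T \<in> space (borel_algebra X) \<rightarrow> topspace X" using assms by (auto simp: continuous_map_def)
  fix U assume "U \<in> {U. openin X U}"
  then have "openin X {x \<in> topspace X. T x \<in> U}" using assms by (simp add: continuous_map_def)
  moreover have "T -` U \<inter> space (borel_algebra X) = {x \<in> topspace X. T x \<in> U}" by auto
  ultimately show "T -` U \<inter> space (borel_algebra X) \<in> sets (borel_algebra X)"
    by (simp add: openin_borel)
qed

lemma continuous_map_real_measurable:
  assumes "continuous_map X euclideanreal g"
  shows "g \<in> borel_measurable (borel_algebra X)"
proof (rule borel_measurableI)
  fix S :: "real set" assume "open S"
  then have "openin X {x \<in> topspace X. g x \<in> S}"
    using assms by (simp add: continuous_map_def)
  moreover have "g -` S \<inter> space (borel_algebra X) = {x \<in> topspace X. g x \<in> S}" by auto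
  ultimately show "g -` S \<inter> space (borel_algebra X) \<in> sets (borel_algebra X)"
    by (simp add: openin_borel)
qed

context compact_system
begin

text \<open>
  Quantize a point by a fixed representative of the first cover element that contains it, and use the
  orbit of the representative as the approximation.
\<close>

lemma rate_distortion_le_covering:
  assumes \<mu>: "prob_space \<mu>" "sets \<mu> = sets (borel_algebra X)"
    and n: "n \<ge> 1" and \<epsilon>: "\<epsilon> > 0"
    and \<U>: "metric_cover X (dyn_metric T d n) \<epsilon> \<U>"
  shows "rate_distortion X T d \<mu> \<epsilon> \<le> ereal (ln (real (card \<U>)) / real n)"
proof -
  interpret \<mu>: prob_space \<mu> by fact
  let ?B = "borel_algebra X"
  have sp: "space \<mu> = topspace X" using sets_eq_imp_space_eq[OF \<mu>(2)] by simp
  obtain x\<^sub>0 where x0: "x\<^sub>0 \<in> topspace X" using \<mu>.not_empty unfolding sp by blast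
  have fin: "finite \<U>" and cov: "topspace X \<subseteq> \<Union>\<U>" and op: "\<And>U. U \<in> \<U> \<Longrightarrow> openin X U"
    using \<U> by (auto simp: metric_cover_def)
  obtain e where e: "bij_betw e {..<card \<U>} \<U>" using ex_bij_betw_nat_finite[OF fin] by (auto simp: atLeast0LessThan)
  have eU: "e i \<in> \<U>" if "i < card \<U>" for i using e that by (auto simp: bij_betw_def)
  have "\<exists>r. 0 \<le> r \<and> r < \<epsilon> \<and> (\<forall>x\<in>U. \<forall>y\<in>U. dyn_metric T d n x y \<le> r)" if "U \<in> \<U>" for U
    using \<U> that by (auto simp: metric_cover_def diam_less_iff[OF \<epsilon>])
  then obtain \<rho> where \<rho>: "\<And>U. U \<in> \<U> \<Longrightarrow> \<rho> U < \<epsilon>"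
      "\<And>U x y. U \<in> \<U> \<Longrightarrow> x \<in> U \<Longrightarrow> y \<in> U \<Longrightarrow> dyn_metric T d n x y \<le> \<rho> U"
    by metis
  define r where "r = Max (insert 0 (\<rho> ` \<U>))"
  have r: "r < \<epsilon>" unfolding r_def using fin \<rho>(1) \<epsilon> by (subst Max_less_iff) auto
  have \<rho>r: "\<rho> U \<le> r" if "U \<in> \<U>" for U unfolding r_def using fin that by (intro Max_ge) auto
  define idx where "idx x = (LEAST i. i < card \<U> \<and> x \<in> e i)" for x
  have idx: "idx x < card \<U> \<and> x \<in> e (idx x)" if x: "x \<in> topspace X" for x
  proof -
    obtain U where "U \<in> \<U>" "x \<in> U" using cov x by blast
    then obtain i where "i < card \<U> \<and> x \<in> e i" using e by (auto simp: bij_betw_def)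
    then show ?thesis unfolding idx_def by (rule LeastI)
  qed
  define c where "c i = (if i < card \<U> \<and> e i \<noteq> {} then SOME p. p \<in> e i else x\<^sub>0)" for i
  have c_in: "c i \<in> e i" if "i < card \<U>" "e i \<noteq> {}" for i
    unfolding c_def using that by (auto intro: someI_ex)
  have c_top: "c i \<in> topspace X" for i
  proof (cases "i < card \<U> \<and> e i \<noteq> {}")
    case True
    then show ?thesis using c_in[of i] op[OF eU[of i]] by (auto dest: openin_subset)
  qed (auto simp: c_def x0)
  have idx_meas: "idx \<in> measurable ?B (count_space UNIV)"
    unfolding idx_def
  proof (rule measurable_Least)
    fix i
    have "{x \<in> space ?B. i < card \<U> \<and> x \<in> e i} \<in> sets ?B"
    proof (cases "i < card \<U>")
      case True
      have "{x \<in> space ?B. i < card \<U> \<and> x \<in> e i} = e i"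
        using True op[OF eU[OF True]] by (auto dest: openin_subset)
      then show ?thesis using openin_borel[OF op[OF eU[OF True]]] by simp
    qed auto
    then show "(\<lambda>x. i < card \<U> \<and> x \<in> e i) \<in> measurable ?B (count_space UNIV)"
      by (rule pred_def[THEN iffD2])
  qed
  \<comment> \<open>the law of \<open>\<mu>\<close>, carried by the first component; the second one is constant\<close>
  define M :: "('a \<times> (nat \<Rightarrow> 'a)) measure"
    where "M = vimage_algebra (topspace X \<times> UNIV) fst ?B"
  define j :: "'a \<Rightarrow> 'a \<times> (nat \<Rightarrow> 'a)" where "j x = (x, undefined)" for x
  define P :: "('a \<times> (nat \<Rightarrow> 'a)) measure" where "P = distr \<mu> M j"
  have inj_meas: "j \<in> measurable \<mu> M"
    unfolding M_def j_def by (rule measurable_vimage_algebra2) (auto simp: sp intro!: measurable_ident_sets \<mu>(2))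
  have P: "prob_space P" unfolding P_def by (rule \<mu>.prob_space_distr[OF inj_meas])
  have spP: "space P = topspace X \<times> UNIV" by (simp add: P_def M_def)
  have fst_meas: "fst \<in> measurable M ?B"
    unfolding M_def by (rule measurable_vimage_algebra1) auto
  then have Z: "fst \<in> measurable P ?B" by (simp add: P_def)
  have lawZ: "distr P ?B fst = \<mu>"
  proof -
    have "distr P ?B fst = distr \<mu> ?B (fst \<circ> j)"
      unfolding P_def by (rule distr_distr[OF fst_meas inj_meas])
    also have "\<dots> = \<mu>" using \<mu>(2) by (simp add: comp_def j_def distr_id2)
    finally show ?thesis .
  qed
  define Y where "Y k = (\<lambda>\<omega> :: 'a \<times> (nat \<Rightarrow> 'a). (T ^^ k) (c (idx (fst \<omega>))))" for k :: nat
  have Y: "Y k \<in> measurable P ?B" for k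
  proof -
    have "(\<lambda>i. (T ^^ k) (c i)) \<in> measurable (count_space UNIV) ?B"
      using iter_in[OF c_top] by simp
    from measurable_compose[OF measurable_compose[OF Z idx_meas] this]
    show ?thesis by (simp add: Y_def)
  qed
  have dist: "1 / real n * (\<Sum>k<n. d ((T ^^ k) (fst \<omega>)) (Y k \<omega>)) \<le> r" if \<omega>: "\<omega> \<in> space P" for \<omega>
  proof -
    let ?x = "fst \<omega>" and ?U = "e (idx (fst \<omega>))"
    have x: "?x \<in> topspace X" using \<omega> spP by auto
    have U: "?U \<in> \<U>" "?x \<in> ?U" "c (idx ?x) \<in> ?U"
      using idx[OF x] eU c_in by blast+
    have "d ((T ^^ k) ?x) (Y k \<omega>) \<le> r" if "k < n" for k
    proof -
      have "d ((T ^^ k) ?x) (Y k \<omega>) \<le> dyn_metric T d n ?x (c (idx ?x))"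
        unfolding Y_def by (rule dyn_metric_ge[OF that])
      then show ?thesis using \<rho>(2)[OF U] \<rho>r[OF U(1)] by linarith
    qed
    then have "(\<Sum>k<n. d ((T ^^ k) ?x) (Y k \<omega>)) \<le> (\<Sum>k<n. r)" by (intro sum_mono) auto
    then show ?thesis using n by (simp add: field_simps)
  qed
  have distortion: "(LINT \<omega>|P. 1 / real n * (\<Sum>k<n. d ((T ^^ k) (fst \<omega>)) (Y k \<omega>))) < \<epsilon>"
  proof (cases "integrable P (\<lambda>\<omega>. 1 / real n * (\<Sum>k<n. d ((T ^^ k) (fst \<omega>)) (Y k \<omega>)))")
    case True
    have "(LINT \<omega>|P. 1 / real n * (\<Sum>k<n. d ((T ^^ k) (fst \<omega>)) (Y k \<omega>))) \<le> r"
      by (rule prob_space.integral_le_const[OF P True]) (use dist in auto)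
    then show ?thesis using r by linarith
  next
    case False
    then show ?thesis using \<epsilon> by (subst not_integrable_integral_eq) auto
  qed
  let ?Y = "\<lambda>\<omega>. \<lambda>k\<in>{..<n}. Y k \<omega>"
  have "mutual_info P ?B (PiM {..<n} (\<lambda>_. ?B)) fst ?Y \<le> ereal (ln (real (card {..<card \<U>})))"
  proof (rule mutual_info_le_ln_card[OF P Z])
    show "?Y \<in> measurable P (PiM {..<n} (\<lambda>_. ?B))" by (rule measurable_restrict) (rule Y)
    show "idx (fst \<omega>) \<in> {..<card \<U>}" if "\<omega> \<in> space P" for \<omega> using idx that spP by auto
    show "?Y \<omega> = (\<lambda>i. \<lambda>k\<in>{..<n}. (T ^^ k) (c i)) (idx (fst \<omega>))" for \<omega> by (simp add: Y_def)
  qed auto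
  then have "mutual_info P ?B (PiM {..<n} (\<lambda>_. ?B)) fst ?Y / ereal (real n) \<le> ereal (ln (real (card \<U>))) / ereal (real n)"
    using n by (intro ereal_divide_right_mono) auto
  also have "\<dots> = ereal (ln (real (card \<U>)) / real n)" using n by simp
  finally have le: "mutual_info P ?B (PiM {..<n} (\<lambda>_. ?B)) fst ?Y / ereal (real n) \<le> ereal (ln (real (card \<U>)) / real n)" .
  show ?thesis
    unfolding rate_distortion_def
    by (rule INF_lower2[of "(n, P, fst, Y)"]) (use n P Z lawZ Y distortion le in auto)
qed

text \<open>
  The rate distortion function stays below the entropy bound \<open>h\<close>, whereas \<open>ln (1 / \<epsilon>)\<close> diverges.
\<close>

lemma rdim_eq_0:
  assumes \<mu>: "prob_space \<mu>" "sets \<mu> = sets (borel_algebra X)"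
    and h: "\<And>\<epsilon>. \<epsilon> > 0 \<Longrightarrow>
      \<forall>\<^sub>F N in sequentially. ln (real (covering_number X (dyn_metric T d N) \<epsilon>)) \<le> h * real N"
  shows "upper_rdim X T d \<mu> = 0" "lower_rdim X T d \<mu> = 0"
proof -
  have R: "rate_distortion X T d \<mu> \<epsilon> \<le> ereal h" if \<epsilon>: "\<epsilon> > 0" for \<epsilon>
  proof -
    obtain N where N: "N \<ge> 1" "ln (real (covering_number X (dyn_metric T d N) \<epsilon>)) \<le> h * real N"
      using eventually_happens[OF eventually_conj[OF h[OF \<epsilon>] eventually_ge_at_top[of 1]]] by auto
    obtain \<U> where \<U>: "metric_cover X (dyn_metric T d N) \<epsilon> \<U>"
      "card \<U> = covering_number X (dyn_metric T d N) \<epsilon>"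
      using covering_number_attained metric_cover_exists[OF N(1) \<epsilon>] by metis
    have "rate_distortion X T d \<mu> \<epsilon> \<le> ereal (ln (real (card \<U>)) / real N)"
      by (rule rate_distortion_le_covering[OF \<mu> N(1) \<epsilon> \<U>(1)])
    also have "\<dots> \<le> ereal h" using N \<U>(2) by (simp add: pos_divide_le_eq)
    finally show ?thesis .
  qed
  have ln_lim: "filterlim (\<lambda>\<epsilon>::real. ln (1 / \<epsilon>)) at_top (at_right 0)"
  proof -
    have "filterlim (\<lambda>\<epsilon>::real. - ln \<epsilon>) at_top (at_right 0)"
      using ln_at_0 by (simp add: filterlim_uminus_at_bot)
    moreover have "\<forall>\<^sub>F \<epsilon> in at_right (0::real). - ln \<epsilon> = ln (1 / \<epsilon>)"
      using eventually_at_right_less[of "0::real"] by eventually_elim (simp add: ln_div)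
    ultimately show ?thesis by (rule filterlim_cong[THEN iffD1, OF refl refl, rotated])
  qed
  have "((\<lambda>\<epsilon>. rate_distortion X T d \<mu> \<epsilon> / ereal (ln (1 / \<epsilon>))) \<longlongrightarrow> 0) (at_right 0)"
  proof (rule tendsto_sandwich)
    have ev: "\<forall>\<^sub>F \<epsilon> in at_right (0::real). 0 < \<epsilon> \<and> \<epsilon> < 1"
      by (auto simp: eventually_at_right_field intro!: exI[of _ 1])
    show "\<forall>\<^sub>F \<epsilon> in at_right 0. 0 \<le> rate_distortion X T d \<mu> \<epsilon> / ereal (ln (1 / \<epsilon>))"
      using ev
    proof eventually_elim
      case (elim \<epsilon>)
      then have "0 \<le> ln (1 / \<epsilon>)" by (simp add: ln_div)
      then show ?case by (intro zero_le_divide_ereal rate_distortion_nonneg) auto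
    qed
    show "\<forall>\<^sub>F \<epsilon> in at_right 0. rate_distortion X T d \<mu> \<epsilon> / ereal (ln (1 / \<epsilon>)) \<le> ereal (h / ln (1 / \<epsilon>))"
      using ev
    proof eventually_elim
      case (elim \<epsilon>)
      then have pos: "0 < ln (1 / \<epsilon>)" by (simp add: ln_div)
      then have "rate_distortion X T d \<mu> \<epsilon> / ereal (ln (1 / \<epsilon>)) \<le> ereal h / ereal (ln (1 / \<epsilon>))"
        using R elim by (intro ereal_divide_right_mono) auto
      then show ?case using pos by simp
    qed
    show "((\<lambda>\<epsilon>. 0 :: ereal) \<longlongrightarrow> 0) (at_right (0::real))" by simp
    have "((\<lambda>\<epsilon>. h / ln (1 / \<epsilon>)) \<longlongrightarrow> 0) (at_right 0)"
      by (rule tendsto_divide_0[OF tendsto_const]) (rule filterlim_at_top_imp_at_infinity[OF ln_lim])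
    then show "((\<lambda>\<epsilon>. ereal (h / ln (1 / \<epsilon>))) \<longlongrightarrow> 0) (at_right 0)"
      by (simp add: zero_ereal_def)
  qed
  then show "upper_rdim X T d \<mu> = 0" "lower_rdim X T d \<mu> = 0"
    unfolding upper_rdim_def lower_rdim_def
    by (auto intro: lim_imp_Limsup lim_imp_Liminf)
qed

end

section \<open>Coding a compact metric space by real numbers\<close>

text \<open>
  The orbit of a point of the middle-thirds Cantor set under this continuous map stays in the outer
  thirds of the unit interval, and the thirds that it visits can be prescribed. This encodes sequences of bits by
  reals in a continuous way.
\<close>

definition tent :: "real \<Rightarrow> real" where
  "tent t = 3 * min t (1 - t)"

lemma tent_continuous: "continuous_on UNIV (tent ^^ n)"
proof (induction n)
  case (Suc n)
  have "continuous_on UNIV tent" unfolding tent_def by (intro continuous_intros)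
  from continuous_on_compose2[OF this Suc] show ?case by (simp add: comp_def)
qed (simp add: id_def)

lemma tent_finite_itinerary:
  "\<exists>t\<in>{0..1}. \<forall>i<n. if b i then 2/3 \<le> (tent ^^ i) t else (tent ^^ i) t \<le> 1/3"
proof (induction n arbitrary: b)
  case (Suc n)
  obtain t where t: "t \<in> {0..1}"
    "\<forall>i<n. if b (Suc i) then 2/3 \<le> (tent ^^ i) t else (tent ^^ i) t \<le> 1/3"
    using Suc[of "\<lambda>i. b (Suc i)"] by auto
  define s where "s = (if b 0 then 1 - t / 3 else t / 3)"
  have s: "s \<in> {0..1}" "tent s = t" "if b 0 then 2/3 \<le> s else s \<le> 1/3"
    using t(1) by (auto simp: s_def tent_def)
  have "if b i then 2/3 \<le> (tent ^^ i) s else (tent ^^ i) s \<le> 1/3" if "i < Suc n" for i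
  proof (cases i)
    case 0
    then show ?thesis using s(3) by (cases "b 0") simp_all
  next
    case (Suc j)
    then have "(tent ^^ i) s = (tent ^^ j) t" using s(2) by (simp add: funpow_swap1)
    moreover have "if b (Suc j) then 2/3 \<le> (tent ^^ j) t else (tent ^^ j) t \<le> 1/3"
    proof -
      have "j < n" using that Suc by simp
      then show ?thesis using t(2) by blast
    qed
    ultimately show ?thesis using Suc by metis
  qed
  then show ?case using s(1) by blast
qed (auto intro: bexI[of _ 0])

lemma tent_itinerary:
  "\<exists>t\<in>{0..1}. \<forall>i. if b i then 2/3 \<le> (tent ^^ i) t else (tent ^^ i) t \<le> 1/3"
proof -
  define Q where "Q i t \<longleftrightarrow> (if b i then 2/3 \<le> (tent ^^ i) t else (tent ^^ i) t \<le> 1/3)" for i t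
  define A where "A n = {t \<in> {0..1}. \<forall>i<n. Q i t}" for n
  have closed: "closed {t. Q i t}" for i
    using tent_continuous[of i] unfolding Q_def
    by (cases "b i") (auto intro!: closed_Collect_le continuous_intros)
  have "compact (A n)" for n
  proof -
    have "A n = {0..1} \<inter> (\<Inter>i\<in>{..<n}. {t. Q i t})" by (auto simp: A_def)
    also have "compact \<dots>" using closed by (intro compact_Int_closed closed_INT) auto
    finally show ?thesis .
  qed
  moreover have "A n \<noteq> {}" for n
    using tent_finite_itinerary[of n b] unfolding A_def Q_def by blast
  moreover have "A n \<subseteq> A m" if "m \<le> n" for m n using that by (auto simp: A_def)
  ultimately have "\<Inter>(range A) \<noteq> {}" by (rule compact_nest)
  then obtain t where t: "\<And>n. t \<in> A n" by blast
  have "Q i t" for i using t[of "Suc i"] by (simp add: A_def)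
  moreover have "t \<in> {0..1}" using t[of 0] by (simp add: A_def)
  ultimately show ?thesis unfolding Q_def by blast
qed

context compact_system
begin

text \<open>
  The functions \<open>d(\<cdot>, s) - q\<close> for \<open>s\<close> in a countable dense set and rational \<open>q\<close>.
\<close>

lemma separating_functions:
  assumes ne: "topspace X \<noteq> {}"
  obtains h :: "nat \<Rightarrow> 'a \<Rightarrow> real"
  where "\<And>n. continuous_map X euclideanreal (h n)"
    and "\<And>x y. x \<in> topspace X \<Longrightarrow> y \<in> topspace X \<Longrightarrow> x \<noteq> y \<Longrightarrow> \<exists>n. h n x < 0 \<and> 0 < h n y"
proof -
  have "\<exists>F. finite F \<and> F \<subseteq> topspace X \<and> (\<forall>x\<in>topspace X. \<exists>s\<in>F. d x s < 1 / real (Suc k))" for k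
    using finite_net[of "1 / real (Suc k)"] by (metis of_nat_0_less_iff zero_less_Suc zero_less_divide_1_iff)
  then obtain F where F: "\<And>k. finite (F k)" "\<And>k. F k \<subseteq> topspace X"
    "\<And>k x. x \<in> topspace X \<Longrightarrow> \<exists>s\<in>F k. d x s < 1 / real (Suc k)"
    by metis
  define I where "I = (\<Union>k. F k) \<times> (\<rat> :: real set)"
  have "countable I" unfolding I_def
    using F(1) by (intro countable_SIGMA countable_UN countable_rat) (auto intro: countable_finite)
  moreover have "I \<noteq> {}"
  proof -
    obtain x where "x \<in> topspace X" using ne by blast
    then obtain s where "s \<in> F 0" using F(3) by blast
    then have "(s, 0) \<in> I" unfolding I_def by auto
    then show ?thesis by blast
  qed
  ultimately have rng: "range (from_nat_into I) = I" by (rule range_from_nat_into[rotated])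
  define h where "h n = (\<lambda>(s, q) x. d x s - q) (from_nat_into I n)" for n
  have "continuous_map X euclideanreal (h n)" for n
  proof -
    obtain s q where sq: "from_nat_into I n = (s, q)" by fastforce
    then have "(s, q) \<in> I" using rng by (metis rangeI)
    then have "s \<in> topspace X" using F(2) by (auto simp: I_def)
    then show ?thesis by (simp add: h_def sq continuous_map_diff continuous_dist)
  qed
  moreover have "\<exists>n. h n x < 0 \<and> 0 < h n y"
    if x: "x \<in> topspace X" and y: "y \<in> topspace X" and xy: "x \<noteq> y" for x y
  proof -
    have pos: "0 < d x y / 2" using M.mdist_pos_less[OF xy x y] by simp
    then obtain k where k: "1 / real (Suc k) < d x y / 2" using nat_approx_posE by metis
    obtain s where s: "s \<in> F k" "d x s < 1 / real (Suc k)" using F(3)[OF x] by blast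
    have "d x y \<le> d x s + d s y" using M.triangle[OF x _ y, of s] s F(2) by blast
    then have "d x s < d y s" using s k M.commute[of s y] by linarith
    then obtain q where q: "q \<in> \<rat>" "d x s < q" "q < d y s" using Rats_dense_in_real by blast
    have "(s, q) \<in> I" using s q by (auto simp: I_def)
    then obtain n where "from_nat_into I n = (s, q)" using rng by (metis imageE)
    then have "h n x < 0 \<and> 0 < h n y" using q by (simp add: h_def)
    then show ?thesis by blast
  qed
  ultimately show thesis by (rule that)
qed

text \<open>
  The \<open>n\<close>th bit of a code of \<open>x\<close> says on which closed side of zero the \<open>n\<close>th separating function lies at
  \<open>x\<close>; both bits are allowed at zero, which keeps the relation \<open>G\<close> between codes and points closed.
  Separation makes \<open>G\<close> the graph of a function \<open>p\<close> on codes. As \<open>X\<close> is compact, projections of closed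
  subsets of \<open>G\<close> to the line are closed; that is the continuity of \<open>p\<close>.
\<close>

lemma real_coding:
  assumes ne: "topspace X \<noteq> {}"
  obtains C :: "real set" and p :: "real \<Rightarrow> 'a"
  where "closed C" "C \<subseteq> {0..1}" "p ` C = topspace X"
    and "\<And>V. closedin X V \<Longrightarrow> closed {t \<in> C. p t \<in> V}"
proof -
  obtain h :: "nat \<Rightarrow> 'a \<Rightarrow> real" where h: "\<And>n. continuous_map X euclideanreal (h n)"
    and sep: "\<And>x y. x \<in> topspace X \<Longrightarrow> y \<in> topspace X \<Longrightarrow> x \<noteq> y \<Longrightarrow> \<exists>n. h n x < 0 \<and> 0 < h n y"
    using separating_functions[OF ne] by blast
  define \<tau> where "\<tau> n t = (tent ^^ n) t" for n t
  define R where "R n t x \<longleftrightarrow> (\<tau> n t \<le> 1/3 \<and> h n x \<le> 0) \<or> (2/3 \<le> \<tau> n t \<and> 0 \<le> h n x)" for n t x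
  define G where "G V = {(t, x). t \<in> {0..1} \<and> x \<in> V \<and> (\<forall>n. R n t x)}" for V
  let ?Y = "prod_topology euclideanreal X"
  have R_closed: "closedin ?Y {z \<in> topspace ?Y. R n (fst z) (snd z)}" for n
  proof -
    have c1: "continuous_map ?Y euclideanreal (\<lambda>z. \<tau> n (fst z))"
    proof -
      have "continuous_map euclideanreal euclideanreal (\<tau> n)"
        using tent_continuous[of n] by (simp add: \<tau>_def)
      from continuous_map_compose[OF continuous_map_fst this] show ?thesis by (simp add: comp_def)
    qed
    have c2: "continuous_map ?Y euclideanreal (\<lambda>z. h n (snd z))"
      using continuous_map_compose[OF continuous_map_snd h[of n]] by (simp add: comp_def)
    have split: "{z \<in> S. (P z \<and> Q z) \<or> (P' z \<and> Q' z)} =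
        ({z \<in> S. P z} \<inter> {z \<in> S. Q z}) \<union> ({z \<in> S. P' z} \<inter> {z \<in> S. Q' z})"
      for S :: "(real \<times> 'a) set" and P Q P' Q'
      by blast
    have "closedin ?Y {z \<in> topspace ?Y. \<tau> n (fst z) \<in> {..1/3}}"
      "closedin ?Y {z \<in> topspace ?Y. \<tau> n (fst z) \<in> {2/3..}}"
      by (rule closedin_continuous_map_preimage[OF c1]; simp)+
    moreover have "closedin ?Y {z \<in> topspace ?Y. h n (snd z) \<in> {..0}}"
      "closedin ?Y {z \<in> topspace ?Y. h n (snd z) \<in> {0..}}"
      by (rule closedin_continuous_map_preimage[OF c2]; simp)+
    ultimately show ?thesis
      unfolding R_def split atMost_iff atLeast_iff by (intro closedin_Un closedin_Int)
  qed
  have G_closed: "closed (fst ` G V)" if V: "closedin X V" for V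
  proof -
    have 1: "closedin ?Y ({0..1} \<times> V)" using V by (simp add: closedin_prod_Times_iff)
    have 2: "closedin ?Y (\<Inter>n. {z \<in> topspace ?Y. R n (fst z) (snd z)})"
      using R_closed by (intro closedin_INT) auto
    have G_eq: "G V = ({0..1} \<times> V) \<inter> (\<Inter>n. {z \<in> topspace ?Y. R n (fst z) (snd z)})"
      using closedin_subset[OF V] by (auto simp: G_def)
    have "closedin ?Y (G V)" unfolding G_eq by (rule closedin_Int[OF 1 2])
    then show ?thesis using closed_map_fst[OF compact, of euclideanreal] by (simp add: closed_map_def)
  qed
  define C where "C = fst ` G (topspace X)"
  have unique: "x = y" if G: "(t, x) \<in> G (topspace X)" "(t, y) \<in> G (topspace X)" for t x y
  proof (rule ccontr)
    assume "x \<noteq> y"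
    then obtain n where "h n x < 0" "0 < h n y" using sep[of x y] G by (auto simp: G_def)
    moreover have "R n t x" "R n t y" using G by (auto simp: G_def)
    ultimately show False by (auto simp: R_def)
  qed
  define p where "p t = (THE x. (t, x) \<in> G (topspace X))" for t
  have p: "p t = x" if "(t, x) \<in> G (topspace X)" for t x
    unfolding p_def using that unique by (intro the_equality) auto
  have pG: "(t, p t) \<in> G (topspace X)" if "t \<in> C" for t
    using that p by (auto simp: C_def)
  have "\<exists>t\<in>C. p t = x" if x: "x \<in> topspace X" for x
  proof -
    obtain t where t: "t \<in> {0..1}"
      "\<forall>n. if 0 \<le> h n x then 2/3 \<le> (tent ^^ n) t else (tent ^^ n) t \<le> 1/3"
      using tent_itinerary[of "\<lambda>n. 0 \<le> h n x"] by blast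
    have "R n t x" for n using t(2)[rule_format, of n] by (auto simp: R_def \<tau>_def split: if_splits)
    then have "(t, x) \<in> G (topspace X)" using t(1) x by (auto simp: G_def)
    then show ?thesis using p by (force simp: C_def)
  qed
  moreover have "p t \<in> topspace X" if "t \<in> C" for t using pG[OF that] by (auto simp: G_def)
  ultimately have onto: "p ` C = topspace X" by blast
  have "{t \<in> C. p t \<in> V} = fst ` G V" if V: "closedin X V" for V
  proof -
    have sub: "V \<subseteq> topspace X" using closedin_subset[OF V] .
    show ?thesis
    proof (intro set_eqI iffI)
      fix t assume "t \<in> {t \<in> C. p t \<in> V}"
      then have "(t, p t) \<in> G V" using pG[of t] by (auto simp: G_def)
      then show "t \<in> fst ` G V" by force
    next
      fix t assume "t \<in> fst ` G V"
      then obtain x where x: "(t, x) \<in> G V" by auto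
      then have "(t, x) \<in> G (topspace X)" "x \<in> V" using sub by (auto simp: G_def)
      then show "t \<in> {t \<in> C. p t \<in> V}" using p by (force simp: C_def)
    qed
  qed
  then have "closed {t \<in> C. p t \<in> V}" if "closedin X V" for V using G_closed[OF that] that by simp
  moreover have "closed C" unfolding C_def by (rule G_closed) simp
  moreover have "C \<subseteq> {0..1}" by (auto simp: C_def G_def)
  ultimately show thesis using onto that by blast
qed

section \<open>Weak limits of measures\<close>

lemma continuous_bounded:
  assumes "continuous_map X euclideanreal g"
  obtains B where "B \<ge> 0" "\<And>x. x \<in> topspace X \<Longrightarrow> \<bar>g x\<bar> \<le> B"
proof -
  have "compactin euclideanreal (g ` topspace X)"
    by (rule image_compactin[OF _ assms]) (use compact in \<open>simp add: compact_space_def\<close>)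
  then have "bounded (g ` topspace X)" by (simp add: compact_imp_bounded)
  then obtain B where B: "\<And>x. x \<in> topspace X \<Longrightarrow> \<bar>g x\<bar> \<le> B"
    by (auto simp: bounded_iff)
  show thesis
    by (rule that[of "max B 0"]) (use B in \<open>auto intro: max.coboundedI1\<close>)
qed

text \<open>
  Push the measures to the line by a section of the coding, which can be arbitrary as the measures are
  discrete. Helly's theorem gives a limit on the line; it is carried by the
  closed set of codes, and its image under the coding is the required measure. Test functions on \<open>X\<close>
  become test functions on the line by Tietze's theorem.
\<close>

lemma weak_limit:
  fixes \<nu> :: "nat \<Rightarrow> 'a pmf"
  assumes \<nu>: "\<And>n. set_pmf (\<nu> n) \<subseteq> topspace X"
  obtains r :: "nat \<Rightarrow> nat" and \<mu> :: "'a measure"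
  where "strict_mono r" "prob_space \<mu>" "sets \<mu> = sets (borel_algebra X)"
    and "\<And>g. continuous_map X euclideanreal g \<Longrightarrow>
      (\<lambda>n. measure_pmf.expectation (\<nu> (r n)) g) \<longlonglongrightarrow> (LINT x|\<mu>. g x)"
proof -
  obtain x\<^sub>0 where x0: "x\<^sub>0 \<in> topspace X" using \<nu>[of 0] set_pmf_not_empty[of "\<nu> 0"] by blast
  obtain C :: "real set" and p :: "real \<Rightarrow> 'a" where C: "closed C" "C \<subseteq> {0..1}" "p ` C = topspace X"
    and p_closed: "\<And>V. closedin X V \<Longrightarrow> closed {t \<in> C. p t \<in> V}"
    using real_coding x0 by blast
  define \<sigma> where "\<sigma> = inv_into C p"
  have \<sigma>: "\<sigma> x \<in> C" "p (\<sigma> x) = x" if "x \<in> topspace X" for x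
    using that C(3) unfolding \<sigma>_def by (auto intro: inv_into_into f_inv_into_f)
  define N where "N n = distr (measure_pmf (\<nu> n)) borel \<sigma>" for n
  have rd: "real_distribution (N n)" for n
    unfolding N_def by (rule prob_space.real_distribution_distr[OF prob_space_measure_pmf]) simp
  have N_int: "integral\<^sup>L (N n) f = measure_pmf.expectation (\<nu> n) (\<lambda>x. f (\<sigma> x))"
    if "f \<in> borel_measurable borel" for n and f :: "real \<Rightarrow> real"
    unfolding N_def by (rule integral_distr) (use that in auto)
  have AE_C: "AE x in measure_pmf (\<nu> n). \<sigma> x \<in> C" for n
    using \<sigma> \<nu> by (auto simp: AE_measure_pmf_iff)
  have "tight N"
    unfolding tight_def
  proof (intro conjI allI impI rd)
    fix e :: real assume "e > 0"
    have "measure (N n) {-1<..1} = 1" for n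
    proof -
      interpret real_distribution "N n" by (rule rd)
      have "AE t in N n. t \<in> {-1<..1}"
        unfolding N_def
      proof (subst AE_distr_iff)
        show "AE x in measure_pmf (\<nu> n). \<sigma> x \<in> {-1<..1}"
          using AE_C[of n]
        proof eventually_elim
          case (elim x)
          then have "\<sigma> x \<in> {0..1}" using C(2) by blast
          then show ?case by simp
        qed
      qed auto
      then show ?thesis by (subst prob_eq_1) auto
    qed
    then show "\<exists>a b. a < b \<and> (\<forall>n. 1 - e < measure (N n) {a<..b})"
      using \<open>e > 0\<close> by (intro exI[of _ "-1"] exI[of _ 1]) auto
  qed
  then obtain r M where r: "strict_mono r" and M: "real_distribution M"
    and conv: "weak_conv_m (N \<circ> id \<circ> r) M"
    using tight_imp_convergent_subsubsequence[of N id] by (auto simp: strict_mono_def)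
  interpret M: real_distribution M by (rule M)
  have lim: "(\<lambda>n. measure_pmf.expectation (\<nu> (r n)) (\<lambda>x. f (\<sigma> x))) \<longlonglongrightarrow> integral\<^sup>L M f"
    if f: "continuous_on UNIV f" "\<And>t. \<bar>f t\<bar> \<le> B" for f :: "real \<Rightarrow> real" and B
  proof -
    have "(\<lambda>n. integral\<^sup>L ((N \<circ> id \<circ> r) n) f) \<longlonglongrightarrow> integral\<^sup>L M f"
    proof (rule weak_conv_imp_integral_bdd_continuous_conv[OF _ M conv])
      show "real_distribution ((N \<circ> id \<circ> r) n)" for n using rd by simp
      show "isCont f x" for x using f(1) by (simp add: continuous_on_eq_continuous_at)
      show "norm (f x) \<le> B" for x using f(2) by simp
    qed
    moreover have "f \<in> borel_measurable borel" using f(1) by (rule borel_measurable_continuous_onI)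
    ultimately show ?thesis using N_int by simp
  qed
  have C_ne: "C \<noteq> {}" using C(3) x0 by auto
  have AE_M: "AE t in M. t \<in> C"
  proof -
    define f where "f t = min 1 (infdist t C)" for t
    have fc: "continuous_on UNIV f" unfolding f_def by (intro continuous_intros)
    have f01: "0 \<le> f t" "\<bar>f t\<bar> \<le> 1" for t by (auto simp: f_def infdist_nonneg)
    have "measure_pmf.expectation (\<nu> (r n)) (\<lambda>x. f (\<sigma> x)) = 0" for n
    proof -
      have "AE x in measure_pmf (\<nu> (r n)). f (\<sigma> x) = 0"
        using AE_C[of "r n"] by eventually_elim (simp add: f_def)
      then show ?thesis by (rule integral_eq_zero_AE)
    qed
    then have "integral\<^sup>L M f = 0" using lim[OF fc f01(2)] by (simp add: LIMSEQ_const_iff)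
    moreover have "integrable M f"
      by (rule M.integrable_const_bound[of _ 1])
        (use f01 borel_measurable_continuous_onI[OF fc] in auto)
    ultimately have "AE t in M. f t = 0" using f01 by (subst (asm) integral_nonneg_eq_0_iff_AE) auto
    then show ?thesis
    proof eventually_elim
      case (elim t)
      then have "infdist t C = 0" by (auto simp: f_def min_def split: if_splits)
      then show "t \<in> C" using in_closed_iff_infdist_zero[OF C(1) C_ne] by simp
    qed
  qed
  define q where "q t = (if t \<in> C then p t else x\<^sub>0)" for t
  have q_meas: "q \<in> measurable M (borel_algebra X)"
  proof (rule measurable_sigma_sets[OF sets_borel_algebra])
    show "{U. openin X U} \<subseteq> Pow (topspace X)" by (auto dest: openin_subset)
    have pC: "p t \<in> topspace X" if "t \<in> C" for t using C(3) that by blast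
    show "q \<in> space M \<rightarrow> topspace X" using pC x0 by (auto simp: q_def)
    fix U assume "U \<in> {U. openin X U}"
    then have U: "openin X U" by simp
    have "closed {t \<in> C. p t \<in> topspace X - U}" by (rule p_closed) (use U in auto)
    moreover have "q -` U \<inter> space M
        = (C - {t \<in> C. p t \<in> topspace X - U}) \<union> (if x\<^sub>0 \<in> U then - C else {})"
      using pC by (auto simp: q_def split: if_splits)
    ultimately show "q -` U \<inter> space M \<in> sets M" using C(1) by (auto intro!: borel_closed)
  qed
  define \<mu> where "\<mu> = distr M (borel_algebra X) q"
  show thesis
  proof (rule that[OF r])
    show "prob_space \<mu>" unfolding \<mu>_def by (rule M.prob_space_distr[OF q_meas])
    show "sets \<mu> = sets (borel_algebra X)" by (simp add: \<mu>_def)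
    fix g assume g: "continuous_map X euclideanreal g"
    obtain B where B: "B \<ge> 0" "\<And>x. x \<in> topspace X \<Longrightarrow> \<bar>g x\<bar> \<le> B" using continuous_bounded[OF g] by blast
    have "continuous_on C (g \<circ> p)"
      unfolding continuous_on_closed_vimage[OF C(1)]
    proof (intro allI impI)
      fix S :: "real set" assume "closed S"
      then have "closedin X {x \<in> topspace X. g x \<in> S}"
        using g by (simp add: continuous_map_closedin)
      from p_closed[OF this] show "closed ((g \<circ> p) -` S \<inter> C)"
        by (rule back_subst[of closed]) (use C(3) in auto)
    qed
    then obtain f where f: "continuous_on UNIV f" "\<And>t. t \<in> C \<Longrightarrow> f t = (g \<circ> p) t" "\<And>t. \<bar>f t\<bar> \<le> B"
      using Tietze[of C "g \<circ> p" UNIV B] C(1,3) B by auto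
    have "measure_pmf.expectation (\<nu> n) (\<lambda>x. f (\<sigma> x)) = measure_pmf.expectation (\<nu> n) g" for n
      using \<nu>[of n] \<sigma> f(2) by (intro integral_cong_AE) (auto simp: AE_measure_pmf_iff)
    then have "(\<lambda>n. measure_pmf.expectation (\<nu> (r n)) g) \<longlonglongrightarrow> integral\<^sup>L M f"
      using lim[OF f(1,3)] by simp
    also have "integral\<^sup>L M f = integral\<^sup>L M (\<lambda>t. g (q t))"
    proof (rule integral_cong_AE)
      show "f \<in> borel_measurable M" using borel_measurable_continuous_onI[OF f(1)] by simp
      show "(\<lambda>t. g (q t)) \<in> borel_measurable M"
        by (rule measurable_compose[OF q_meas continuous_map_real_measurable[OF g]])
      show "AE t in M. f t = g (q t)"
        using AE_M by eventually_elim (simp add: f(2) q_def)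
    qed
    also have "\<dots> = (LINT x|\<mu>. g x)"
      unfolding \<mu>_def by (rule integral_distr[OF q_meas continuous_map_real_measurable[OF g], symmetric])
    finally show "(\<lambda>n. measure_pmf.expectation (\<nu> (r n)) g) \<longlonglongrightarrow> (LINT x|\<mu>. g x)" .
  qed
qed

text \<open>
  The distance to the complement.
\<close>

lemma open_set_as_positivity_set:
  assumes U: "openin X U"
  obtains u where "continuous_map X euclideanreal u" "\<And>x. x \<in> topspace X \<Longrightarrow> 0 \<le> u x"
    "U = {x \<in> topspace X. 0 < u x}"
proof (cases "topspace X - U = {}")
  case True
  then have "U = topspace X" using openin_subset[OF U] by blast
  then show ?thesis using that[of "\<lambda>_. 1"] by simp
next
  case False
  define V where "V = topspace X - U"
  have V: "V \<noteq> {}" "V \<subseteq> topspace X" using False by (auto simp: V_def)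
  define u where "u x = (INF y\<in>V. d x y)" for x
  have bdd: "bdd_below (d x ` V)" for x by (rule bdd_belowI2[of _ 0]) simp
  have le: "u x \<le> d x y" if "y \<in> V" for x y unfolding u_def by (rule cINF_lower[OF bdd that])
  have ge: "b \<le> u x" if "\<And>y. y \<in> V \<Longrightarrow> b \<le> d x y" for b x
    unfolding u_def by (rule cINF_greatest[OF V(1) that])
  have lip: "u x \<le> u y + d x y" if "x \<in> topspace X" "y \<in> topspace X" for x y
  proof -
    have "u x - d x y \<le> u y"
    proof (rule ge)
      fix z assume z: "z \<in> V"
      then have "d x z \<le> d x y + d y z" using that V by (intro M.triangle) auto
      then show "u x - d x y \<le> d y z" using le[OF z, of x] by linarith
    qed
    then show ?thesis by simp
  qed
  have "continuous_map (mtopology_of (metric (topspace X, d))) (mtopology_of euclidean_metric) u"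
  proof (rule Lipschitz_continuous_imp_continuous_map)
    show "Lipschitz_continuous_map (metric (topspace X, d)) euclidean_metric u"
      unfolding Lipschitz_continuous_map_def
    proof (intro conjI exI[of _ 1] ballI)
      fix x y assume "x \<in> mspace (metric (topspace X, d))" "y \<in> mspace (metric (topspace X, d))"
      then have xy: "x \<in> topspace X" "y \<in> topspace X" by auto
      show "mdist euclidean_metric (u x) (u y) \<le> 1 * mdist (metric (topspace X, d)) x y"
        using lip[OF xy] lip[OF xy(2,1)] M.commute[of x y] by (simp add: dist_real_def abs_le_iff)
    qed auto
  qed
  then have cont: "continuous_map X euclideanreal u" by (simp add: mtop)
  have nonneg: "0 \<le> u x" for x by (rule ge) simp
  have "U = {x \<in> topspace X. 0 < u x}"
  proof (intro set_eqI iffI)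
    fix x assume x: "x \<in> U"
    then obtain r where r: "r > 0" "M.mball x r \<subseteq> U"
      using U M.openin_mtopology[of U] by (auto simp: mtop)
    have xX: "x \<in> topspace X" using x openin_subset[OF U] by blast
    have "r \<le> u x"
    proof (rule ge)
      fix y assume "y \<in> V"
      then have "y \<notin> M.mball x r" "y \<in> topspace X" using r by (auto simp: V_def)
      then show "r \<le> d x y" using xX by (simp add: not_less)
    qed
    then show "x \<in> {x \<in> topspace X. 0 < u x}" using r xX by simp
  next
    fix x assume x: "x \<in> {x \<in> topspace X. 0 < u x}"
    show "x \<in> U"
    proof (rule ccontr)
      assume "x \<notin> U"
      then have "x \<in> V" using x by (simp add: V_def)
      then have "u x \<le> d x x" by (rule le)
      then show False using x by simp
    qed
  qed
  then show ?thesis using that cont nonneg by blast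
qed

lemma integrable_continuous:
  assumes "prob_space \<mu>" "sets \<mu> = sets (borel_algebra X)" "continuous_map X euclideanreal g"
  shows "integrable \<mu> g"
proof -
  interpret prob_space \<mu> by fact
  have sp: "space \<mu> = topspace X" using sets_eq_imp_space_eq[OF assms(2)] by simp
  obtain B where B: "B \<ge> 0" "\<And>x. x \<in> topspace X \<Longrightarrow> \<bar>g x\<bar> \<le> B" using continuous_bounded[OF assms(3)] by blast
  show ?thesis
  proof (rule integrable_const_bound[of _ B])
    show "AE x in \<mu>. norm (g x) \<le> B" using B sp by (intro AE_I2) auto
    show "g \<in> borel_measurable \<mu>"
      using continuous_map_real_measurable[OF assms(3)] measurable_cong_sets[OF assms(2) refl] by auto
  qed
qed

text \<open>
  An open set is the positivity set of some continuous \<open>u \<ge> 0\<close>, so its indicator is the increasing limit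
  of \<open>min 1 (n u)\<close>; open sets form a generating \<open>\<pi>\<close>-system.
\<close>

lemma measure_eq_if_integrals_eq:
  assumes \<mu>: "prob_space \<mu>" "sets \<mu> = sets (borel_algebra X)"
    and \<nu>: "prob_space \<nu>" "sets \<nu> = sets (borel_algebra X)"
    and eq: "\<And>g. continuous_map X euclideanreal g \<Longrightarrow> (LINT x|\<mu>. g x) = (LINT x|\<nu>. g x)"
  shows "\<mu> = \<nu>"
proof (rule measure_eqI_generator_eq[where E = "{U. openin X U}" and \<Omega> = "topspace X" and A = "\<lambda>_. topspace X"])
  show "Int_stable {U. openin X U}" by (auto simp: Int_stable_def)
  show "{U. openin X U} \<subseteq> Pow (topspace X)" by (auto dest: openin_subset)
  show "sets \<mu> = sigma_sets (topspace X) {U. openin X U}" using \<mu> by (simp add: sets_borel_algebra)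
  show "sets \<nu> = sigma_sets (topspace X) {U. openin X U}" using \<nu> by (simp add: sets_borel_algebra)
  interpret A: prob_space \<mu> by fact
  interpret B: prob_space \<nu> by fact
  show "emeasure \<mu> (topspace X) \<noteq> \<infinity>" for i :: nat by simp
  fix U assume "U \<in> {U. openin X U}"
  then have U: "openin X U" by simp
  obtain u where u: "continuous_map X euclideanreal u" "\<And>x. x \<in> topspace X \<Longrightarrow> 0 \<le> u x"
    "U = {x \<in> topspace X. 0 < u x}" using open_set_as_positivity_set[OF U] by blast
  define g where "g n x = min 1 (real n * u x)" for n x
  have gc: "continuous_map X euclideanreal (g n)" for n
    unfolding g_def using u(1) by (intro continuous_intros) auto
  have lim: "(\<lambda>n. LINT x|\<kappa>. g n x) \<longlonglongrightarrow> measure \<kappa> U"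
    if \<kappa>: "prob_space \<kappa>" "sets \<kappa> = sets (borel_algebra X)" for \<kappa> :: "'a measure"
  proof -
    interpret prob_space \<kappa> by fact
    have sp: "space \<kappa> = topspace X" using sets_eq_imp_space_eq[OF \<kappa>(2)] by simp
    have Us: "U \<in> sets \<kappa>" using openin_borel[OF U] \<kappa>(2) by simp
    have "(\<lambda>n. LINT x|\<kappa>. g n x) \<longlonglongrightarrow> (LINT x|\<kappa>. indicator U x)"
    proof (rule integral_dominated_convergence[where w = "\<lambda>_. 1"])
      show "(indicator U :: 'a \<Rightarrow> real) \<in> borel_measurable \<kappa>" using Us by simp
      show "g n \<in> borel_measurable \<kappa>" for n
        using integrable_continuous[OF \<kappa> gc] by (rule borel_measurable_integrable)
      show "integrable \<kappa> (\<lambda>_. 1 :: real)" by simp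
      show "AE x in \<kappa>. norm (g n x) \<le> 1" for n
        using u(2) sp by (intro AE_I2) (auto simp: g_def)
      show "AE x in \<kappa>. (\<lambda>n. g n x) \<longlonglongrightarrow> indicator U x"
      proof (rule AE_I2)
        fix x assume x: "x \<in> space \<kappa>"
        show "(\<lambda>n. g n x) \<longlonglongrightarrow> indicator U x"
        proof (cases "x \<in> U")
          case True
          then have pos: "0 < u x" using u(3) by simp
          obtain m :: nat where m: "1 < real m * u x" using ex_less_of_nat_mult[OF pos] by blast
          have "g n x = 1" if "n \<ge> m" for n
          proof -
            have "real m * u x \<le> real n * u x" using that pos by (intro mult_right_mono) auto
            then show ?thesis using m by (simp add: g_def)
          qed
          then have "\<forall>\<^sub>F n in sequentially. g n x = 1" by (auto simp: eventually_sequentially)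
          then show ?thesis using True by (simp add: tendsto_eventually)
        next
          case False
          then have "u x = 0" using u(2)[of x] u(3) x sp by force
          then show ?thesis using False by (simp add: g_def)
        qed
      qed
    qed
    moreover have "(LINT x|\<kappa>. indicator U x) = measure \<kappa> U" using Us by (simp add: )
    ultimately show ?thesis by simp
  qed
  have "(\<lambda>n. LINT x|\<mu>. g n x) \<longlonglongrightarrow> measure \<nu> U" using lim[OF \<nu>] eq[OF gc] by simp
  then have "measure \<mu> U = measure \<nu> U" using lim[OF \<mu>] LIMSEQ_unique by blast
  then show "emeasure \<mu> U = emeasure \<nu> U" by (simp add: A.emeasure_eq_measure B.emeasure_eq_measure)
qed auto

text \<open>
  Replacing \<open>g\<close> by \<open>g \<circ> T\<close> changes an orbit average over \<open>Suc n\<close> points only by its two end terms, so the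
  limit is invariant. The averages are taken over \<open>Suc (r n)\<close> points to exclude the empty average.
\<close>

lemma empirical_limit:
  assumes x: "\<And>n. x n \<in> topspace X"
  obtains r :: "nat \<Rightarrow> nat" and \<mu> :: "'a measure"
  where "strict_mono r" "\<mu> \<in> invariant_measures X T"
    and "\<And>g. continuous_map X euclideanreal g \<Longrightarrow>
      (\<lambda>n. (\<Sum>i<Suc (r n). g ((T ^^ i) (x (r n)))) / real (Suc (r n))) \<longlonglongrightarrow> (LINT x|\<mu>. g x)"
proof -
  define \<nu> where "\<nu> n = map_pmf (\<lambda>i. (T ^^ i) (x n)) (pmf_of_set {..<Suc n})" for n
  have "set_pmf (\<nu> n) \<subseteq> topspace X" for n
    using iter_in[OF x] by (auto simp: \<nu>_def)
  then obtain r \<mu> where r: "strict_mono r" and \<mu>: "prob_space \<mu>" "sets \<mu> = sets (borel_algebra X)"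
    and lim: "\<And>g. continuous_map X euclideanreal g \<Longrightarrow>
      (\<lambda>n. measure_pmf.expectation (\<nu> (r n)) g) \<longlonglongrightarrow> (LINT x|\<mu>. g x)"
    using weak_limit[of \<nu>] by blast
  have exp: "measure_pmf.expectation (\<nu> n) g = (\<Sum>i<Suc n. g ((T ^^ i) (x n))) / real (Suc n)"
    for n and g :: "'a \<Rightarrow> real"
  proof -
    have "{..<Suc n} \<noteq> {}" by blast
    then show ?thesis unfolding \<nu>_def by (simp add: integral_pmf_of_set del: sum.lessThan_Suc)
  qed
  have Tm: "T \<in> measurable \<mu> \<mu>"
    using continuous_map_borel_measurable[OF cont] measurable_cong_sets[OF \<mu>(2) \<mu>(2)] by simp
  have "distr \<mu> \<mu> T = \<mu>"
  proof (rule measure_eq_if_integrals_eq)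
    show "prob_space (distr \<mu> \<mu> T)" by (rule prob_space.prob_space_distr[OF \<mu>(1) Tm])
    show "sets (distr \<mu> \<mu> T) = sets (borel_algebra X)" using \<mu>(2) by simp
    show "prob_space \<mu>" "sets \<mu> = sets (borel_algebra X)" by fact+
    fix g assume g: "continuous_map X euclideanreal g"
    have gT: "continuous_map X euclideanreal (\<lambda>x. g (T x))"
      using continuous_map_compose[OF cont g] by (simp add: comp_def)
    obtain B where B: "B \<ge> 0" "\<And>x. x \<in> topspace X \<Longrightarrow> \<bar>g x\<bar> \<le> B" using continuous_bounded[OF g] by blast
    let ?E = "\<lambda>n g. measure_pmf.expectation (\<nu> (r n)) g"
    have "(\<lambda>n. ?E n (\<lambda>x. g (T x)) - ?E n g) \<longlonglongrightarrow> 0"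
    proof (rule Lim_null_comparison)
      show "\<forall>\<^sub>F n in sequentially. norm (?E n (\<lambda>x. g (T x)) - ?E n g) \<le> 2 * B / real (Suc (r n))"
      proof (intro always_eventually allI)
        fix n
        let ?y = "x (r n)" and ?m = "Suc (r n)"
        have "(\<Sum>i<?m. g (T ((T ^^ i) ?y))) - (\<Sum>i<?m. g ((T ^^ i) ?y)) = g ((T ^^ ?m) ?y) - g ?y"
          using sum_lessThan_telescope[of "\<lambda>i. g ((T ^^ i) ?y)" ?m]
          by (simp add: sum_subtractf del: sum.lessThan_Suc)
        then have "?E n (\<lambda>x. g (T x)) - ?E n g = (g ((T ^^ ?m) ?y) - g ?y) / real ?m"
          unfolding exp by (metis diff_divide_distrib)
        moreover have "\<bar>g ((T ^^ ?m) ?y) - g ?y\<bar> \<le> 2 * B"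
          using B(2)[OF iter_in[OF x[of "r n"], of ?m]] B(2)[OF x[of "r n"]] by linarith
        ultimately show "norm (?E n (\<lambda>x. g (T x)) - ?E n g) \<le> 2 * B / real ?m"
          by (simp add: abs_divide divide_right_mono del: of_nat_Suc)
      qed
      have "(\<lambda>n. 2 * B / real n) \<longlonglongrightarrow> 0" by (rule lim_const_over_n)
      then have "(\<lambda>n. 2 * B / real (Suc n)) \<longlonglongrightarrow> 0" by (rule LIMSEQ_Suc)
      from LIMSEQ_subseq_LIMSEQ[OF this r] show "(\<lambda>n. 2 * B / real (Suc (r n))) \<longlonglongrightarrow> 0"
        by (simp add: comp_def)
    qed
    moreover have "(\<lambda>n. ?E n (\<lambda>x. g (T x)) - ?E n g) \<longlonglongrightarrow> (LINT x|\<mu>. g (T x)) - (LINT x|\<mu>. g x)"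
      by (intro tendsto_diff lim g gT)
    ultimately have "(LINT x|\<mu>. g (T x)) - (LINT x|\<mu>. g x) = 0" by (rule LIMSEQ_unique[rotated])
    moreover have "(LINT x|distr \<mu> \<mu> T. g x) = (LINT x|\<mu>. g (T x))"
      by (rule integral_distr[OF Tm borel_measurable_integrable[OF integrable_continuous[OF \<mu> g]]])
    ultimately show "(LINT x|distr \<mu> \<mu> T. g x) = (LINT x|\<mu>. g x)" by simp
  qed
  then have "\<mu> \<in> invariant_measures X T" using \<mu> by (simp add: invariant_measures_def)
  then show thesis using that[OF r] lim exp by simp
qed

end

section \<open>The variational principle for the potential\<close>

locale potential_system = compact_system +
  fixes \<phi> :: "nat \<Rightarrow> 'a \<Rightarrow> real" and K :: real
  assumes potential: "subadditive_potential X T \<phi>"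
    and increment: "\<And>n x. n \<ge> 1 \<Longrightarrow> x \<in> topspace X \<Longrightarrow> \<bar>\<phi> (n + 1) x - \<phi> n x\<bar> \<le> K"
    and K_nonneg: "K \<ge> 0"
    and nonempty: "topspace X \<noteq> {}"
begin

lemma phi_cont: "n \<ge> 1 \<Longrightarrow> continuous_map X euclideanreal (\<phi> n)"
  using potential by (simp add: subadditive_potential_def)

lemma phi_sub: "n \<ge> 1 \<Longrightarrow> m \<ge> 1 \<Longrightarrow> x \<in> topspace X \<Longrightarrow> \<phi> (n + m) x \<le> \<phi> n x + \<phi> m ((T ^^ n) x)"
  using potential by (simp add: subadditive_potential_def)

lemma phi_increment:
  assumes "n \<ge> 1" "x \<in> topspace X"
  shows "\<bar>\<phi> (n + j) x - \<phi> n x\<bar> \<le> K * real j"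
proof (induction j)
  case (Suc j)
  have "\<bar>\<phi> (n + j + 1) x - \<phi> (n + j) x\<bar> \<le> K" using assms by (intro increment) auto
  then show ?case using Suc by (simp add: algebra_simps)
qed simp

lemma phi_bound:
  obtains B where "B \<ge> 0" "\<And>n x. n \<ge> 1 \<Longrightarrow> x \<in> topspace X \<Longrightarrow> \<bar>\<phi> n x\<bar> \<le> B * real n"
proof -
  obtain B where B: "B \<ge> 0" "\<And>x. x \<in> topspace X \<Longrightarrow> \<bar>\<phi> 1 x\<bar> \<le> B"
    using continuous_bounded[OF phi_cont[of 1]] by auto
  have "\<bar>\<phi> n x\<bar> \<le> (B + K) * real n" if n: "n \<ge> 1" and x: "x \<in> topspace X" for n x
  proof -
    have "\<bar>\<phi> (1 + (n - 1)) x - \<phi> 1 x\<bar> \<le> K * real (n - 1)" using x by (intro phi_increment) auto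
    then have "\<bar>\<phi> n x\<bar> \<le> B + K * real (n - 1)" using B(2)[OF x] n by simp
    also have "\<dots> \<le> B * real n + K * real n"
      using B(1) K_nonneg n by (intro add_mono mult_left_mono) (auto simp: mult_le_cancel_left1)
    finally show ?thesis by (simp add: algebra_simps)
  qed
  then show thesis using that[of "B + K"] B(1) K_nonneg by simp
qed

definition max_phi :: "nat \<Rightarrow> real" where
  "max_phi n = (SUP x\<in>topspace X. \<phi> n x)"

lemma phi_le_max:
  assumes n: "n \<ge> 1" and x: "x \<in> topspace X"
  shows "\<phi> n x \<le> max_phi n"
proof -
  obtain B where B: "\<And>n x. n \<ge> 1 \<Longrightarrow> x \<in> topspace X \<Longrightarrow> \<bar>\<phi> n x\<bar> \<le> B * real n"
    using phi_bound by metis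
  have "bdd_above (\<phi> n ` topspace X)"
    by (rule bdd_aboveI2[of _ _ "B * real n"]) (use B[OF n] in \<open>auto simp: abs_le_iff\<close>)
  then show ?thesis unfolding max_phi_def using x by (rule cSUP_upper[rotated])
qed

lemma max_phi_least: "(\<And>x. x \<in> topspace X \<Longrightarrow> \<phi> n x \<le> b) \<Longrightarrow> max_phi n \<le> b"
  unfolding max_phi_def by (rule cSUP_least[OF nonempty])

lemma max_phi_ereal:
  assumes "n \<ge> 1"
  shows "(SUP x\<in>topspace X. ereal (\<phi> n x)) = ereal (max_phi n)"
proof (rule SUP_eqI)
  show "ereal (\<phi> n x) \<le> ereal (max_phi n)" if "x \<in> topspace X" for x
    using phi_le_max[OF assms that] by simp
  fix y assume y: "\<And>x. x \<in> topspace X \<Longrightarrow> ereal (\<phi> n x) \<le> y"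
  obtain x where x: "x \<in> topspace X" using nonempty by blast
  show "ereal (max_phi n) \<le> y"
  proof (cases y)
    case (real b)
    then show ?thesis using y by (auto intro: max_phi_least)
  qed (use y[OF x] in auto)
qed

lemma max_phi_growth:
  obtains \<Phi> where "(\<lambda>n. max_phi n / real n) \<longlonglongrightarrow> \<Phi>"
    "\<And>n. n \<ge> 1 \<Longrightarrow> \<Phi> \<le> max_phi n / real n"
proof -
  obtain B where B: "\<And>n x. n \<ge> 1 \<Longrightarrow> x \<in> topspace X \<Longrightarrow> \<bar>\<phi> n x\<bar> \<le> B * real n"
    using phi_bound by metis
  obtain x where x: "x \<in> topspace X" using nonempty by blast
  show thesis
  proof (rule fekete[of max_phi "- B"])
    fix n m :: nat assume nm: "n \<ge> 1" "m \<ge> 1"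
    show "max_phi (n + m) \<le> max_phi n + max_phi m"
    proof (rule max_phi_least)
      fix y assume y: "y \<in> topspace X"
      show "\<phi> (n + m) y \<le> max_phi n + max_phi m"
        using phi_sub[OF nm y] phi_le_max[OF nm(1) y] phi_le_max[OF nm(2) iter_in[OF y, of n]]
        by linarith
    qed
  next
    fix n :: nat assume n: "n \<ge> 1"
    show "- B * real n \<le> max_phi n" using B[OF n x] phi_le_max[OF n x] by linarith
  qed (use that in blast)
qed

text \<open>
  Cutting the orbit into blocks of length \<open>m\<close> bounds \<open>\<phi> N\<close> by a sum of values of \<open>\<phi> m\<close> along an
  arithmetic progression of step \<open>m\<close>. Averaging over the \<open>m\<close> starting points \<open>T\<^sup>j x\<close> fills in the
  progression to a full Birkhoff sum, and the increment bound makes a change of the starting point cost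
  a constant.
\<close>

lemma birkhoff_bound:
  assumes m: "m \<ge> 1"
  obtains C where "\<And>N x. N \<ge> 1 \<Longrightarrow> x \<in> topspace X \<Longrightarrow>
    real m * \<phi> N x \<le> (\<Sum>i<N. \<phi> m ((T ^^ i) x)) + C"
proof -
  obtain B where B: "B \<ge> 0" "\<And>n x. n \<ge> 1 \<Longrightarrow> x \<in> topspace X \<Longrightarrow> \<bar>\<phi> n x\<bar> \<le> B * real n"
    using phi_bound by metis
  define b where "b = B * real m"
  have b: "\<bar>\<phi> s x\<bar> \<le> b" if "1 \<le> s" "s \<le> m" "x \<in> topspace X" for s x
  proof -
    have "B * real s \<le> b" unfolding b_def using B(1) that by (intro mult_left_mono) auto
    then show ?thesis using B(2)[OF that(1,3)] by linarith
  qed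
  have split: "(\<Sum>i<k + l. f i) = (\<Sum>i<k. f i) + (\<Sum>i<l. f (k + i))" for f :: "nat \<Rightarrow> real" and k l
    by (induction l) auto
  have blocks: "(\<Sum>j<m. \<phi> (q * m + s) ((T ^^ j) x)) \<le> (\<Sum>i<q * m. \<phi> m ((T ^^ i) x)) + real m * b"
    if s: "1 \<le> s" "s \<le> m" and x: "x \<in> topspace X" for q s x
    using x
  proof (induction q arbitrary: x)
    case 0
    have "(\<Sum>j<m. \<phi> s ((T ^^ j) x)) \<le> (\<Sum>j<m. b)"
      using b[OF s iter_in[OF 0]] by (intro sum_mono) (auto simp: abs_le_iff)
    then show ?case by simp
  next
    case (Suc q)
    have Tx: "(T ^^ m) x \<in> topspace X" by (rule iter_in[OF Suc.prems])
    have "(\<Sum>j<m. \<phi> (Suc q * m + s) ((T ^^ j) x))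
        \<le> (\<Sum>j<m. \<phi> m ((T ^^ j) x) + \<phi> (q * m + s) ((T ^^ j) ((T ^^ m) x)))"
    proof (rule sum_mono)
      fix j
      have "\<phi> (m + (q * m + s)) ((T ^^ j) x)
          \<le> \<phi> m ((T ^^ j) x) + \<phi> (q * m + s) ((T ^^ m) ((T ^^ j) x))"
        using m s by (intro phi_sub iter_in Suc.prems) auto
      moreover have "(T ^^ m) ((T ^^ j) x) = (T ^^ j) ((T ^^ m) x)"
        by (metis funpow_add add.commute comp_apply)
      ultimately show "\<phi> (Suc q * m + s) ((T ^^ j) x)
          \<le> \<phi> m ((T ^^ j) x) + \<phi> (q * m + s) ((T ^^ j) ((T ^^ m) x))"
        by (simp add: add.assoc)
    qed
    also have "\<dots> = (\<Sum>j<m. \<phi> m ((T ^^ j) x)) + (\<Sum>j<m. \<phi> (q * m + s) ((T ^^ j) ((T ^^ m) x)))"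
      by (rule sum.distrib)
    also have "\<dots> \<le> (\<Sum>j<m. \<phi> m ((T ^^ j) x)) + ((\<Sum>i<q * m. \<phi> m ((T ^^ i) ((T ^^ m) x))) + real m * b)"
      using Suc.IH[OF Tx] by simp
    also have "(\<Sum>i<q * m. \<phi> m ((T ^^ i) ((T ^^ m) x))) = (\<Sum>i<q * m. \<phi> m ((T ^^ (m + i)) x))"
      by (intro sum.cong refl) (metis funpow_add add.commute comp_apply)
    finally show ?case using split[of "\<lambda>i. \<phi> m ((T ^^ i) x)" m "q * m"] by simp
  qed
  show thesis
  proof (rule that[of "real m * (b + K * real m) + real m * b + real m * b"])
    fix N x assume N: "N \<ge> (1::nat)" and x: "x \<in> topspace X"
    have shift: "\<phi> N x \<le> \<phi> N ((T ^^ j) x) + (b + K * real m)" if j: "j < m" for j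
    proof (cases "j = 0")
      case True
      have "0 \<le> b" unfolding b_def using B(1) by simp
      then show ?thesis using True K_nonneg by simp
    next
      case False
      have "\<phi> N x \<le> \<phi> (N + j) x + K * real j" using phi_increment[OF N x, of j] by linarith
      moreover have "\<phi> (j + N) x \<le> \<phi> j x + \<phi> N ((T ^^ j) x)"
        using False N x by (intro phi_sub) auto
      moreover have "\<phi> j x \<le> b" using b[of j x] False j x by (simp add: abs_le_iff)
      moreover have "K * real j \<le> K * real m" using K_nonneg j by (intro mult_left_mono) auto
      ultimately show ?thesis by (simp add: add.commute)
    qed
    have "real m * \<phi> N x = (\<Sum>j<m. \<phi> N x)" by simp
    also have "\<dots> \<le> (\<Sum>j<m. \<phi> N ((T ^^ j) x) + (b + K * real m))"
      using shift by (intro sum_mono) auto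
    also have "\<dots> = (\<Sum>j<m. \<phi> N ((T ^^ j) x)) + real m * (b + K * real m)"
      by (simp add: sum.distrib)
    finally have 1: "real m * \<phi> N x \<le> (\<Sum>j<m. \<phi> N ((T ^^ j) x)) + real m * (b + K * real m)" .
    \<comment> \<open>the remainder is taken in \<open>1..m\<close>, since \<open>\<phi> 0\<close> is arbitrary\<close>
    define q s where "q = (N - 1) div m" and "s = Suc ((N - 1) mod m)"
    have Ns: "N = q * m + s" using N by (simp add: q_def s_def)
    have "(N - 1) mod m < m" using m by (intro mod_less_divisor) simp
    then have s: "1 \<le> s" "s \<le> m" by (simp_all add: s_def Suc_le_eq)
    have 2: "(\<Sum>j<m. \<phi> N ((T ^^ j) x)) \<le> (\<Sum>i<q * m. \<phi> m ((T ^^ i) x)) + real m * b"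
      unfolding Ns by (rule blocks[OF s x])
    have "(\<Sum>i<s. - b) \<le> (\<Sum>i<s. \<phi> m ((T ^^ (q * m + i)) x))"
      using b[OF m order_refl iter_in[OF x]] by (intro sum_mono) (auto simp: abs_le_iff minus_le_iff)
    moreover have "real s * b \<le> real m * b"
      using s B(1) by (intro mult_right_mono) (auto simp: b_def)
    ultimately have 3: "(\<Sum>i<q * m. \<phi> m ((T ^^ i) x)) \<le> (\<Sum>i<N. \<phi> m ((T ^^ i) x)) + real m * b"
      unfolding Ns split by simp
    show "real m * \<phi> N x \<le> (\<Sum>i<N. \<phi> m ((T ^^ i) x))
        + (real m * (b + K * real m) + real m * b + real m * b)"
      using 1 2 3 by linarith
  qed
qed

lemma potential_average_eq:
  assumes \<mu>: "\<mu> \<in> invariant_measures X T"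
  obtains L where "potential_average \<phi> \<mu> = ereal L"
    "(\<lambda>n. (LINT x|\<mu>. \<phi> n x) / real n) \<longlonglongrightarrow> L"
proof -
  have ps: "prob_space \<mu>" and sets: "sets \<mu> = sets (borel_algebra X)" and inv: "distr \<mu> \<mu> T = \<mu>"
    using \<mu> by (auto simp: invariant_measures_def)
  interpret prob_space \<mu> by (rule ps)
  have sp: "space \<mu> = topspace X" using sets_eq_imp_space_eq[OF sets] by simp
  have int: "integrable \<mu> (\<phi> n)" if "n \<ge> 1" for n
    by (rule integrable_continuous[OF ps sets phi_cont[OF that]])
  have Tm: "T \<in> measurable \<mu> \<mu>"
    using continuous_map_borel_measurable[OF cont] measurable_cong_sets[OF sets sets] by simp
  have inv_int: "(LINT x|\<mu>. g ((T ^^ n) x)) = (LINT x|\<mu>. g x)"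
    if g: "continuous_map X euclideanreal g" for g n
    using g
  proof (induction n arbitrary: g)
    case (Suc n)
    have gT: "continuous_map X euclideanreal (\<lambda>x. g (T x))"
      using continuous_map_compose[OF cont Suc.prems] by (simp add: comp_def)
    have "(LINT x|\<mu>. g ((T ^^ Suc n) x)) = (LINT x|\<mu>. g (T x))"
      using Suc.IH[OF gT] by simp
    also have "\<dots> = (LINT x|distr \<mu> \<mu> T. g x)"
      by (rule integral_distr[symmetric, OF Tm
            borel_measurable_integrable[OF integrable_continuous[OF ps sets Suc.prems]]])
    finally show ?case by (simp add: inv)
  qed simp
  obtain B where B: "\<And>n x. n \<ge> 1 \<Longrightarrow> x \<in> topspace X \<Longrightarrow> \<bar>\<phi> n x\<bar> \<le> B * real n"
    using phi_bound by metis
  obtain L where L: "(\<lambda>n. (LINT x|\<mu>. \<phi> n x) / real n) \<longlonglongrightarrow> L"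
  proof (rule fekete[of "\<lambda>n. LINT x|\<mu>. \<phi> n x" "- B"])
    fix n m :: nat assume nm: "n \<ge> 1" "m \<ge> 1"
    have c: "continuous_map X euclideanreal (\<lambda>x. \<phi> m ((T ^^ n) x))"
      using continuous_map_compose[OF cont_iter phi_cont[OF nm(2)]] by (simp add: comp_def)
    note i = integrable_continuous[OF ps sets c]
    have "(LINT x|\<mu>. \<phi> (n + m) x) \<le> (LINT x|\<mu>. \<phi> n x + \<phi> m ((T ^^ n) x))"
      using nm int i phi_sub sp by (intro integral_mono) auto
    also have "\<dots> = (LINT x|\<mu>. \<phi> n x) + (LINT x|\<mu>. \<phi> m x)"
      using int[OF nm(1)] i inv_int[OF phi_cont[OF nm(2)], of n] by simp
    finally show "(LINT x|\<mu>. \<phi> (n + m) x) \<le> (LINT x|\<mu>. \<phi> n x) + (LINT x|\<mu>. \<phi> m x)" .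
  next
    fix n :: nat assume n: "n \<ge> 1"
    have "AE x in \<mu>. - B * real n \<le> \<phi> n x"
      using B[OF n] sp by (intro AE_I2) (auto simp: abs_le_iff minus_le_iff)
    then show "- B * real n \<le> (LINT x|\<mu>. \<phi> n x)" by (rule integral_ge_const[OF int[OF n]])
  qed blast
  have "(\<lambda>n. ereal (1 / real n * (LINT x|\<mu>. \<phi> n x))) \<longlonglongrightarrow> ereal L" using L by simp
  then have "potential_average \<phi> \<mu> = ereal L" unfolding potential_average_def by (rule limI)
  then show thesis using that L by blast
qed

text \<open>
  For the lower bound, let \<open>y n\<close> nearly maximize \<open>\<phi> n\<close>. The Birkhoff bound turns \<open>\<Phi> \<le> max_phi N / N\<close> into
  a lower bound for the orbit averages of \<open>\<phi> m\<close> at \<open>y N\<close>, which passes to the limit measure for every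
  fixed \<open>m\<close>.
\<close>

lemma sup_potential_average:
  assumes \<Phi>: "(\<lambda>n. max_phi n / real n) \<longlonglongrightarrow> \<Phi>" "\<And>n. n \<ge> 1 \<Longrightarrow> \<Phi> \<le> max_phi n / real n"
  shows "(SUP \<mu>\<in>invariant_measures X T. potential_average \<phi> \<mu>) = ereal \<Phi>"
proof (rule antisym)
  show "(SUP \<mu>\<in>invariant_measures X T. potential_average \<phi> \<mu>) \<le> ereal \<Phi>"
  proof (rule SUP_least)
    fix \<mu> assume \<mu>: "\<mu> \<in> invariant_measures X T"
    then have ps: "prob_space \<mu>" and sets: "sets \<mu> = sets (borel_algebra X)"
      by (auto simp: invariant_measures_def)
    interpret prob_space \<mu> by (rule ps)
    have sp: "space \<mu> = topspace X" using sets_eq_imp_space_eq[OF sets] by simp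
    obtain L where L: "potential_average \<phi> \<mu> = ereal L"
      "(\<lambda>n. (LINT x|\<mu>. \<phi> n x) / real n) \<longlonglongrightarrow> L"
      using potential_average_eq[OF \<mu>] by blast
    have "L \<le> \<Phi>"
    proof (rule LIMSEQ_le[OF L(2) \<Phi>(1)], intro exI[of _ 1] allI impI divide_right_mono)
      fix n :: nat assume n: "n \<ge> 1"
      show "(LINT x|\<mu>. \<phi> n x) \<le> max_phi n"
        by (rule integral_le_const[OF integrable_continuous[OF ps sets phi_cont[OF n]]])
          (use phi_le_max[OF n] sp in auto)
    qed auto
    then show "potential_average \<phi> \<mu> \<le> ereal \<Phi>" using L(1) by simp
  qed
next
  have "\<exists>x\<in>topspace X. max_phi n - 1 \<le> \<phi> n x" for n
  proof (rule ccontr)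
    assume "\<not> (\<exists>x\<in>topspace X. max_phi n - 1 \<le> \<phi> n x)"
    then have "max_phi n \<le> max_phi n - 1" by (intro max_phi_least) auto
    then show False by simp
  qed
  then obtain y where y: "\<And>n. y n \<in> topspace X" "\<And>n. max_phi n - 1 \<le> \<phi> n (y n)" by metis
  obtain r \<mu> where r: "strict_mono (r :: nat \<Rightarrow> nat)" and \<mu>: "\<mu> \<in> invariant_measures X T"
    and lim: "\<And>g. continuous_map X euclideanreal g \<Longrightarrow>
      (\<lambda>n. (\<Sum>i<Suc (r n). g ((T ^^ i) (y (Suc (r n))))) / real (Suc (r n))) \<longlonglongrightarrow> (LINT x|\<mu>. g x)"
    using empirical_limit[of "\<lambda>n. y (Suc n)"] y(1) by blast
  obtain L where L: "potential_average \<phi> \<mu> = ereal L"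
    "(\<lambda>n. (LINT x|\<mu>. \<phi> n x) / real n) \<longlonglongrightarrow> L"
    using potential_average_eq[OF \<mu>] by blast
  have "\<Phi> \<le> (LINT x|\<mu>. \<phi> m x) / real m" if m: "m \<ge> 1" for m
  proof -
    obtain C where C: "\<And>N x. N \<ge> 1 \<Longrightarrow> x \<in> topspace X \<Longrightarrow>
        real m * \<phi> N x \<le> (\<Sum>i<N. \<phi> m ((T ^^ i) x)) + C"
      using birkhoff_bound[OF m] by blast
    have bound: "real m * \<Phi> \<le> (\<Sum>i<N. \<phi> m ((T ^^ i) (y N))) / real N + (C + real m) / real N"
      if N: "N \<ge> 1" for N
    proof -
      have "real N * \<Phi> \<le> max_phi N" using \<Phi>(2)[OF N] N by (simp add: field_simps)
      then have "real m * (real N * \<Phi> - 1) \<le> real m * \<phi> N (y N)"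
        using y(2)[of N] by (intro mult_left_mono) auto
      also have "\<dots> \<le> (\<Sum>i<N. \<phi> m ((T ^^ i) (y N))) + C" by (rule C[OF N y(1)])
      finally have "real N * (real m * \<Phi>) \<le> (\<Sum>i<N. \<phi> m ((T ^^ i) (y N))) + (C + real m)"
        by (simp add: algebra_simps)
      then have "real m * \<Phi> \<le> ((\<Sum>i<N. \<phi> m ((T ^^ i) (y N))) + (C + real m)) / real N"
        using N by (simp add: pos_le_divide_eq mult.commute)
      then show ?thesis by (simp only: add_divide_distrib)
    qed
    have le: "real m * \<Phi> \<le> (\<Sum>i<Suc (r n). \<phi> m ((T ^^ i) (y (Suc (r n))))) / real (Suc (r n))
        + (C + real m) / real (Suc (r n))" for n
      by (rule bound) simp
    have "(\<lambda>n. (C + real m) / real n) \<longlonglongrightarrow> 0" by (rule lim_const_over_n)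
    then have "(\<lambda>n. (C + real m) / real (Suc n)) \<longlonglongrightarrow> 0" by (rule LIMSEQ_Suc)
    from LIMSEQ_subseq_LIMSEQ[OF this r]
    have "(\<lambda>n. (C + real m) / real (Suc (r n))) \<longlonglongrightarrow> 0" by (simp add: comp_def)
    from tendsto_add[OF lim[OF phi_cont[OF m]] this]
    have "real m * \<Phi> \<le> (LINT x|\<mu>. \<phi> m x) + 0" by (rule LIMSEQ_le_const) (use le in blast)
    then show ?thesis using m by (simp add: field_simps)
  qed
  then have "\<Phi> \<le> L" by (intro LIMSEQ_le_const[OF L(2)]) blast
  then show "ereal \<Phi> \<le> (SUP \<mu>\<in>invariant_measures X T. potential_average \<phi> \<mu>)"
    using L(1) \<mu> by (intro SUP_upper2[of \<mu>]) auto
qed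

section \<open>Mean dimension\<close>

lemma mdim_eq:
  assumes h: "\<And>\<epsilon>. \<epsilon> > 0 \<Longrightarrow>
      \<forall>\<^sub>F N in sequentially. ln (real (covering_number X (dyn_metric T d N) \<epsilon>)) \<le> h * real N"
    and \<Phi>: "(\<lambda>n. max_phi n / real n) \<longlonglongrightarrow> \<Phi>"
  shows "mdim X T d \<phi> = ereal \<Phi>"
proof -
  have widim_ge: "ereal (max_phi N) \<le> widim X (dyn_metric T d N) \<epsilon> (\<phi> N)" if N: "N \<ge> 1" for N \<epsilon>
    unfolding widim_def
  proof (rule INF_greatest, clarify)
    fix K f
    have "ereal (max_phi N) = (SUP x\<in>topspace X. ereal (\<phi> N x))" using max_phi_ereal[OF N] by simp
    also have "\<dots> \<le> (SUP x\<in>topspace X. ereal (real (local_dim K (f x)) + \<phi> N x))"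
      by (rule SUP_mono') simp
    finally show "ereal (max_phi N) \<le> (SUP x\<in>topspace X. ereal (real (local_dim K (f x)) + \<phi> N x))" .
  qed
  have lim: "(\<lambda>N. widim X (dyn_metric T d N) \<epsilon> (\<phi> N) / ereal (real N)) \<longlonglongrightarrow> ereal \<Phi>"
    if \<epsilon>: "\<epsilon> > 0" for \<epsilon>
  proof (rule order_tendstoI)
    fix a assume a: "a < ereal \<Phi>"
    have "\<forall>\<^sub>F N in sequentially. a < ereal (max_phi N / real N)"
      by (rule order_tendstoD(1)[OF _ a]) (use \<Phi> in simp)
    then show "\<forall>\<^sub>F N in sequentially. a < widim X (dyn_metric T d N) \<epsilon> (\<phi> N) / ereal (real N)"
      using eventually_ge_at_top[of 1]
    proof eventually_elim
      case (elim N)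
      have "ereal (max_phi N / real N) = ereal (max_phi N) / ereal (real N)" using elim by simp
      also have "\<dots> \<le> widim X (dyn_metric T d N) \<epsilon> (\<phi> N) / ereal (real N)"
        using widim_ge elim by (intro ereal_divide_right_mono) auto
      finally show ?case using elim(1) by (rule less_le_trans[rotated])
    qed
  next
    fix a assume "ereal \<Phi> < a"
    then obtain b where b: "\<Phi> < b" "ereal b < a" using ereal_dense2 by (metis less_ereal.simps(1))
    define \<delta> where "\<delta> = (b - \<Phi>) / 2"
    have \<delta>: "\<delta> > 0" using b(1) by (simp add: \<delta>_def)
    have "\<forall>\<^sub>F N in sequentially. max_phi N / real N < \<Phi> + \<delta>"
      by (rule order_tendstoD(2)[OF \<Phi>]) (use \<delta> in simp)
    moreover have "\<forall>\<^sub>F N in sequentially. \<exists>K f. finite_complex K \<and>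
       eps_embedding X (dyn_metric T d N) \<epsilon> (realization K) f \<and>
       (\<forall>x\<in>topspace X. real (local_dim K (f x)) \<le> \<delta> * real N)"
      by (rule low_dimensional_embedding[OF \<epsilon> \<delta>]) (rule h)
    ultimately show "\<forall>\<^sub>F N in sequentially. widim X (dyn_metric T d N) \<epsilon> (\<phi> N) / ereal (real N) < a"
      using eventually_ge_at_top[of 1]
    proof eventually_elim
      case (elim N)
      then obtain K f where K: "finite_complex K"
        "eps_embedding X (dyn_metric T d N) \<epsilon> (realization K) f"
        "\<And>x. x \<in> topspace X \<Longrightarrow> real (local_dim K (f x)) \<le> \<delta> * real N"
        by blast
      have "widim X (dyn_metric T d N) \<epsilon> (\<phi> N)
          \<le> (SUP x\<in>topspace X. ereal (real (local_dim K (f x)) + \<phi> N x))"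
        unfolding widim_def by (rule INF_lower2[of "(K, f)"]) (use K in auto)
      also have "\<dots> \<le> ereal (\<delta> * real N + max_phi N)"
      proof (rule SUP_least)
        fix x assume x: "x \<in> topspace X"
        show "ereal (real (local_dim K (f x)) + \<phi> N x) \<le> ereal (\<delta> * real N + max_phi N)"
          using K(3)[OF x] phi_le_max[OF elim(3) x] by simp
      qed
      finally have "widim X (dyn_metric T d N) \<epsilon> (\<phi> N) / ereal (real N)
          \<le> ereal (\<delta> * real N + max_phi N) / ereal (real N)"
        using elim(3) by (intro ereal_divide_right_mono) auto
      also have "\<dots> = ereal (\<delta> + max_phi N / real N)" using elim(3) by (simp add: add_divide_distrib)
      also have "\<dots> < ereal b" using elim(1) by (simp add: \<delta>_def field_simps)
      finally show ?case using b(2) by (rule less_trans)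
    qed
  qed
  have "\<forall>\<^sub>F \<epsilon> in at_right 0.
      lim (\<lambda>N. widim X (dyn_metric T d N) \<epsilon> (\<phi> N) / ereal (real N)) = ereal \<Phi>"
    using eventually_at_right_less[of "0::real"]
    by eventually_elim (rule limI[OF lim])
  then have "((\<lambda>\<epsilon>. lim (\<lambda>N. widim X (dyn_metric T d N) \<epsilon> (\<phi> N) / ereal (real N))) \<longlongrightarrow> ereal \<Phi>) (at_right 0)"
    by (rule tendsto_eventually)
  then show ?thesis unfolding mdim_def by (intro tendsto_Lim) auto
qed

end

section \<open>The double variational principle\<close>

text \<open>
  On the empty space the widim is a supremum over the empty set; on the other side there are no
  invariant measures. Both sides of the theorem are then \<open>-\<infinity>\<close>.
\<close>

lemma mdim_empty:
  assumes "topspace X = {}"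
  shows "mdim X T d \<phi> = -\<infinity>"
proof -
  have "widim X (dyn_metric T d N) \<epsilon> (\<phi> N) = -\<infinity>" for N \<epsilon>
  proof -
    have "eps_embedding X (dyn_metric T d N) \<epsilon> (realization {}) (\<lambda>_. undefined)"
      using assms by (auto simp: eps_embedding_def realization_def continuous_map_def)
    moreover have "finite_complex {}" by (simp add: finite_complex_def)
    ultimately have "widim X (dyn_metric T d N) \<epsilon> (\<phi> N) \<le>
        (SUP x\<in>topspace X. ereal (real (local_dim {} undefined) + \<phi> N x))"
      unfolding widim_def by (intro INF_lower2[of "({}, \<lambda>_. undefined)"]) auto
    then show ?thesis using assms by (simp add: bot_ereal_def)
  qed
  then have "(\<lambda>N. widim X (dyn_metric T d N) \<epsilon> (\<phi> N) / ereal (real N)) \<longlonglongrightarrow> -\<infinity>" for \<epsilon>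
    using eventually_ge_at_top[of "1::nat"]
    by (intro tendsto_eventually, elim eventually_mono) (simp)
  then have "lim (\<lambda>N. widim X (dyn_metric T d N) \<epsilon> (\<phi> N) / ereal (real N)) = -\<infinity>" for \<epsilon>
    by (rule limI)
  then show ?thesis unfolding mdim_def by (intro tendsto_Lim) auto
qed

theorem theorem1p2:
  fixes X :: "'a topology" and T :: "'a \<Rightarrow> 'a"
    and \<phi> :: "nat \<Rightarrow> 'a \<Rightarrow> real" and K :: real and d\<^sub>0 :: "'a \<Rightarrow> 'a \<Rightarrow> real"
  assumes "dynamical_system X T"
    and "marker_property X T"
    and "\<And>d. d \<in> compatible_metrics X \<Longrightarrow> upper_metric_mdim X T d < \<infinity>"
    and "subadditive_potential X T \<phi>"
    and "bounded_distortion X T \<phi>"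
    and "K > 0"
    and "\<And>n x. n \<ge> 1 \<Longrightarrow> x \<in> topspace X \<Longrightarrow> \<bar>\<phi> (n + 1) x - \<phi> n x\<bar> \<le> K"
    and "d\<^sub>0 \<in> compatible_metrics X"
  shows "is_minimum (mdim X T d\<^sub>0 \<phi>)
           (\<lambda>d. SUP \<mu>\<in>invariant_measures X T. upper_rdim X T d \<mu> + potential_average \<phi> \<mu>)
           (compatible_metrics X) \<and>
         is_minimum (mdim X T d\<^sub>0 \<phi>)
           (\<lambda>d. SUP \<mu>\<in>invariant_measures X T. lower_rdim X T d \<mu> + potential_average \<phi> \<mu>)
           (compatible_metrics X)"
proof -
  have sys: "compact_system X T d" if "d \<in> compatible_metrics X" for d
    using assms(1) that
    by unfold_locales (auto simp: dynamical_system_def dest: homeomorphic_imp_continuous_map)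
  have const: "(SUP \<mu>\<in>invariant_measures X T. upper_rdim X T d \<mu> + potential_average \<phi> \<mu>) = mdim X T d\<^sub>0 \<phi>
      \<and> (SUP \<mu>\<in>invariant_measures X T. lower_rdim X T d \<mu> + potential_average \<phi> \<mu>) = mdim X T d\<^sub>0 \<phi>"
    if d: "d \<in> compatible_metrics X" for d
  proof (cases "topspace X = {}")
    case True
    have "invariant_measures X T = {}"
    proof (rule ccontr)
      assume "invariant_measures X T \<noteq> {}"
      then obtain \<mu> where \<mu>: "prob_space \<mu>" "sets \<mu> = sets (borel_algebra X)"
        by (auto simp: invariant_measures_def)
      then show False
        using prob_space.not_empty[OF \<mu>(1)] sets_eq_imp_space_eq[OF \<mu>(2)] True by simp
    qed
    then show ?thesis using mdim_empty[OF True] by (simp add: bot_ereal_def)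
  next
    case False
    interpret S: potential_system X T d\<^sub>0 \<phi> K
      using sys[OF assms(8)] assms(4,6,7) False
      by (intro potential_system.intro potential_system_axioms.intro) auto
    obtain \<Phi> where \<Phi>: "(\<lambda>n. S.max_phi n / real n) \<longlonglongrightarrow> \<Phi>" "\<And>n. n \<ge> 1 \<Longrightarrow> \<Phi> \<le> S.max_phi n / real n"
      using S.max_phi_growth by blast
    obtain h where "\<And>\<epsilon>. \<epsilon> > 0 \<Longrightarrow>
        \<forall>\<^sub>F N in sequentially. ln (real (covering_number X (dyn_metric T d\<^sub>0 N) \<epsilon>)) \<le> h * real N"
      using finite_entropy[OF sys[OF assms(8)] False assms(3)] by blast
    from S.mdim_eq[OF this \<Phi>(1)] have m: "mdim X T d\<^sub>0 \<phi> = ereal \<Phi>" .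
    obtain h' where h': "\<And>\<epsilon>. \<epsilon> > 0 \<Longrightarrow>
        \<forall>\<^sub>F N in sequentially. ln (real (covering_number X (dyn_metric T d N) \<epsilon>)) \<le> h' * real N"
      using finite_entropy[OF sys[OF d] False assms(3)] by blast
    have "upper_rdim X T d \<mu> = 0 \<and> lower_rdim X T d \<mu> = 0" if "\<mu> \<in> invariant_measures X T" for \<mu>
      using compact_system.rdim_eq_0[OF sys[OF d] _ _ h'] that by (auto simp: invariant_measures_def)
    then show ?thesis using S.sup_potential_average[OF \<Phi>] m by (simp cong: SUP_cong)
  qed
  then show ?thesis using assms(8) unfolding is_minimum_def by auto
qed

end
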